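(* There is no compact metrizable space $X$ such that every spiral over $[0,1]$ (that is, every space homeomorphic to a metrizable compactification of the ray $[0,\infty)$ with remainder an arc) is homeomorphic to exactly one component of $X$.
   Context: For a continuum (compact connected metrizable space) $K$, a spiral over $K$ is any space homeomorphic to a metrizable compactification of $[0,\infty)$ (equivalently, of $(0,1]$) whose remainder is homeomorphic to $K$. An arc is a space homeomorphic to $[0,1]$. No requirement is placed on the components of $X$ other than the stated one; in particular $X$ may have components which are not spirals over $[0,1]$. *)

theory Defs
  imports "HOL-Analysis.Analysis"
begin

definition metrizable_compactification ::
    "'a topology \<Rightarrow> 'b topology \<Rightarrow> ('a \<Rightarrow> 'b) \<Rightarrow> bool" where
  "metrizable_compactification R S e \<longleftrightarrow>
     compact_space S \<and> metrizable_space S \<and> embedding_map R S e \<and>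
     S closure_of (e ` topspace R) = topspace S"

definition remainder_of :: "'a topology \<Rightarrow> 'b topology \<Rightarrow> ('a \<Rightarrow> 'b) \<Rightarrow> 'b topology" where
  "remainder_of R S e = subtopology S (topspace S - e ` topspace R)"

text \<open>The embedding of the ray is existentially quantified, so this notion is invariant under
  homeomorphism (lemma \<open>spiral_over_homeomorphic\<close>): it already describes all spaces homeomorphic
  to a compactification of the ray with remainder homeomorphic to \<open>K\<close>.\<close>

definition spiral_over :: "'k topology \<Rightarrow> 'b topology \<Rightarrow> bool" where
  "spiral_over K S \<longleftrightarrow>
     (\<exists>e. metrizable_compactification (top_of_set {0::real..}) S e \<and>
          remainder_of (top_of_set {0::real..}) S e homeomorphic_space K)"

lemma spiral_over_homeomorphic:
  assumes S: "spiral_over K S" and ST: "S homeomorphic_space T"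
  shows "spiral_over K T"
proof -
  let ?R = "top_of_set {0::real..}"
  obtain e where c: "compact_space S" "metrizable_space S" and e: "embedding_map ?R S e"
    and d: "S closure_of (e ` topspace ?R) = topspace S"
    and r: "subtopology S (topspace S - e ` topspace ?R) homeomorphic_space K"
    using S unfolding spiral_over_def metrizable_compactification_def remainder_of_def by blast
  obtain h where h: "homeomorphic_map S T h"
    using ST homeomorphic_space by blast
  have e': "embedding_map ?R T (h \<circ> e)"
    using e h embedding_map_compose surjective_embedding_map by blast
  have sub: "e ` topspace ?R \<subseteq> topspace S"
    using e unfolding embedding_map_def
    by (meson continuous_map_image_subset_topspace continuous_map_in_subtopology
        homeomorphic_imp_continuous_map)
  have "T closure_of (h ` (e ` topspace ?R)) = h ` (S closure_of (e ` topspace ?R))"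
    using homeomorphic_map_closure_of[OF h sub] by simp
  then have d': "T closure_of ((h \<circ> e) ` topspace ?R) = topspace T"
    using d h homeomorphic_imp_surjective_map by (metis image_comp)
  have im: "h ` (topspace S - e ` topspace ?R) = topspace T - (h \<circ> e) ` topspace ?R"
    using homeomorphic_imp_surjective_map[OF h] homeomorphic_imp_injective_map[OF h] sub
    by (metis Diff_subset image_comp inj_on_image_set_diff)
  have "homeomorphic_map (subtopology S (topspace S - e ` topspace ?R))
          (subtopology T (topspace T - (h \<circ> e) ` topspace ?R)) h"
    by (rule homeomorphic_map_subtopologies[OF h]) (use im in \<open>auto simp: inf_absorb2\<close>)
  then have "subtopology T (topspace T - (h \<circ> e) ` topspace ?R) homeomorphic_space K"
    using r homeomorphic_map_imp_homeomorphic_space homeomorphic_space_sym homeomorphic_space_trans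
    by blast
  then show ?thesis
    unfolding spiral_over_def metrizable_compactification_def remainder_of_def
    using c ST e' d' homeomorphic_compact_space homeomorphic_metrizable_space by blast
qed

text \<open>HOL cannot quantify over all types inside a proposition.  The following facts show that
  quantifying over \<open>(nat \<Rightarrow> real) topology\<close> ranges over all compact metrizable spaces, and hence
  over all spirals, up to homeomorphism.  No relation to the product topology is required.\<close>

lemma compact_metrizable_homeomorphic_copy:
  fixes S :: "'a topology"
  assumes "compact_space S" "metrizable_space S"
  shows "\<exists>T :: (nat \<Rightarrow> real) topology. S homeomorphic_space T"
proof -
  obtain M d where "Metric_space M d" and S: "S = Metric_space.mtopology M d"
    using assms(2) unfolding metrizable_space_def by blast
  interpret Metric_space M d by fact
  have "mtotally_bounded M"
    using assms(1) S compact_space_eq_mcomplete_mtotally_bounded by blast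
  then have "\<forall>n::nat. \<exists>K. finite K \<and> K \<subseteq> M \<and> M \<subseteq> (\<Union>x\<in>K. mball x (inverse (Suc n)))"
    unfolding mtotally_bounded_def by (metis inverse_positive_iff_positive of_nat_0_less_iff zero_less_Suc)
  then obtain K where K: "\<And>n::nat. finite (K n)" "\<And>n. K n \<subseteq> M"
    "\<And>n. M \<subseteq> (\<Union>x\<in>K n. mball x (inverse (Suc n)))"
    by metis
  define D where "D = (\<Union>n. K n)"
  have "countable D" unfolding D_def using K(1) by (simp add: countable_finite)
  have DM: "D \<subseteq> M" using K(2) by (auto simp: D_def)
  define g where "g = (\<lambda>x n. d x (from_nat_into D n))"
  have inj: "inj_on g M"
  proof (rule inj_onI, rule ccontr)
    fix x y assume xy: "x \<in> M" "y \<in> M" "g x = g y" "x \<noteq> y"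
    then have "d x y / 2 > 0" by simp
    then obtain n where n: "inverse (Suc n) < d x y / 2"
      using reals_Archimedean by blast
    obtain q where q: "q \<in> K n" "x \<in> mball q (inverse (Suc n))"
      using K(3) xy(1) by blast
    then have "q \<in> D" by (auto simp: D_def)
    then obtain m where "q = from_nat_into D m"
      using \<open>countable D\<close> by (metis from_nat_into_surj)
    then have "d x q = d y q" using xy(3) unfolding g_def by metis
    moreover have "d x q < d x y / 2" using q n by (auto simp: commute)
    moreover have "d x y \<le> d x q + d y q"
      using xy q DM \<open>q \<in> D\<close> by (metis triangle'' commute subsetD)
    ultimately show False by simp
  qed
  have tS: "topspace S = M" by (simp add: S)
  define f where "f = inv_into M g"
  define T where "T = pullback_topology (g ` M) f S"
  have fg: "\<And>x. x \<in> M \<Longrightarrow> f (g x) = x" using inj by (simp add: f_def)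
  have tT: "topspace T = g ` M"
    unfolding T_def topspace_pullback_topology using fg tS by auto
  have "continuous_map T S f"
    unfolding T_def using continuous_map_pullback[of S S id "g ` M" f] by simp
  moreover have "continuous_map S T g"
    unfolding T_def
  proof (rule continuous_map_pullback')
    have "continuous_map S S id" by simp
    then show "continuous_map S S (f \<circ> g)"
      by (rule continuous_map_eq) (simp add: fg tS)
    show "topspace S \<subseteq> g -` (g ` M)" using tS by auto
  qed
  ultimately have "homeomorphic_maps S T g f"
    unfolding homeomorphic_maps_def using fg tT tS by auto
  then show ?thesis unfolding homeomorphic_space_def by blast
qed

lemma spiral_over_homeomorphic_copy:
  assumes "spiral_over K S"
  shows "\<exists>T :: (nat \<Rightarrow> real) topology. spiral_over K T \<and> S homeomorphic_space T"
  using assms compact_metrizable_homeomorphic_copy spiral_over_homeomorphic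
  unfolding spiral_over_def metrizable_compactification_def by metis

end

theory Submission
  imports Defs
begin

text \<open>Let \<open>x\<close> range over the Cantor space. The spiral of \<open>x\<close> winds around an arc with peaks of height
  \<open>1\<close> or \<open>1/2\<close> as prescribed by the bits of \<open>x\<close>, so that finitely many bits do not affect its
  homeomorphism type. For a clopen subset \<open>U\<close> of the compactum \<open>X\<close>, the set \<open>A U\<close> of those \<open>x\<close> whose
  spiral is homeomorphic to a component of \<open>X\<close> inside \<open>U\<close> is analytic, hence has the Baire
  property, and it is invariant under changing finitely many bits. Uniqueness makes \<open>A U\<close> and
  \<open>A (X - U)\<close> almost disjoint, so one of the two is meager. As there are only countably many
  clopen sets, almost all spirals share one component and are homeomorphic. This is absurd: for fixed
  \<open>x\<close> a generic \<open>y\<close> has runs of low peaks that are too long to be matched with the peaks of \<open>x\<close>.\<close>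

section \<open>Meager sets and the Baire property of analytic sets\<close>

text \<open>Counting cannot give the contradiction: a compactum may have continuum many components,
  enough for all spirals. The obstacle is that the component belonging to \<open>x\<close> may
  depend on \<open>x\<close> in an uncontrolled way. Clopen sets reduce this dependence to countably
  many yes-no questions, and the Baire property makes each answer constant up to a meager set.
  Definability comes from the fact that a homeomorphism is determined by its values on a countable
  dense set, so it can be searched for in a compact space of sequences. Of the Baire property only
  one half is derived: a nonmeager \<open>A U\<close> is comeager in some nonempty open set. A flip
  of finitely many bits brings two such open sets together. The code compares runs instead of single
  bits because a homeomorphism of spirals is flexible. It may deform the remainder by any
  homeomorphism of the arc that fixes the ends, so height \<open>1\<close> is rigid while
  \<open>1/2\<close> merely represents an interior height, and peaks can be counted only up to a
  bounded shift.\<close>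

definition meager :: "'a::topological_space set \<Rightarrow> bool" where
  "meager A \<longleftrightarrow> (\<exists>F :: nat \<Rightarrow> 'a set. (\<forall>n. closed (F n) \<and> interior (F n) = {}) \<and> A \<subseteq> (\<Union>n. F n))"

lemma meager_subset: "meager B \<Longrightarrow> A \<subseteq> B \<Longrightarrow> meager A"
  unfolding meager_def by (meson order_trans)

lemma meager_nowhere_dense: "closed F \<Longrightarrow> interior F = {} \<Longrightarrow> meager F"
  unfolding meager_def by (intro exI[of _ "\<lambda>_. F"]) auto

lemma meager_empty: "meager {}"
  by (simp add: meager_nowhere_dense)

lemma meager_UN_nat:
  fixes A :: "nat \<Rightarrow> 'a::topological_space set"
  assumes "\<And>n. meager (A n)"
  shows "meager (\<Union>n. A n)"
proof -
  have "\<forall>n. \<exists>F :: nat \<Rightarrow> 'a set. (\<forall>m. closed (F m) \<and> interior (F m) = {}) \<and> A n \<subseteq> (\<Union>m. F m)"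
    using assms unfolding meager_def by blast
  then obtain F :: "nat \<Rightarrow> nat \<Rightarrow> 'a set"
    where F: "\<And>n m. closed (F n m) \<and> interior (F n m) = {}" "\<And>n. A n \<subseteq> (\<Union>m. F n m)"
    by metis
  show ?thesis
    unfolding meager_def
  proof (intro exI conjI allI)
    fix k
    show "closed (case prod_decode k of (n, m) \<Rightarrow> F n m)"
      and "interior (case prod_decode k of (n, m) \<Rightarrow> F n m) = {}"
      using F(1) by (simp_all add: prod.case_eq_if)
    show "(\<Union>n. A n) \<subseteq> (\<Union>k. case prod_decode k of (n, m) \<Rightarrow> F n m)"
    proof
      fix x assume "x \<in> (\<Union>n. A n)"
      then obtain n m where "x \<in> F n m" using F(2) by blast
      then have "x \<in> (case prod_decode (prod_encode (n, m)) of (n, m) \<Rightarrow> F n m)" by simp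
      then show "x \<in> (\<Union>k. case prod_decode k of (n, m) \<Rightarrow> F n m)" by (rule UN_I[OF UNIV_I])
    qed
  qed
qed

lemma meager_UN:
  assumes "countable I" "\<And>i. i \<in> I \<Longrightarrow> meager (A i)"
  shows "meager (\<Union>i\<in>I. A i)"
proof (cases "I = {}")
  case False
  have "meager (\<Union>n. A (from_nat_into I n))"
    using assms False by (intro meager_UN_nat) (simp add: from_nat_into)
  then show ?thesis
  proof (rule meager_subset, safe)
    fix i x assume "i \<in> I" "x \<in> A i"
    moreover obtain n where "from_nat_into I n = i"
      using from_nat_into_surj[OF assms(1) \<open>i \<in> I\<close>] by blast
    ultimately show "x \<in> (\<Union>n. A (from_nat_into I n))" by blast
  qed
qed (simp add: meager_empty)

lemma meager_Un: "meager A \<Longrightarrow> meager B \<Longrightarrow> meager (A \<union> B)"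
  using meager_UN[of "{A, B}" id] by auto

lemma meager_closed_minus_interior: "closed F \<Longrightarrow> meager (F - interior F)"
proof (rule meager_nowhere_dense)
  assume "closed F"
  then show "closed (F - interior F)" by (simp add: closed_Diff)
  have "interior (F - interior F) \<subseteq> interior F" by (simp add: interior_mono)
  then show "interior (F - interior F) = {}" using interior_subset by blast
qed

lemma meager_closure_minus_open: "open W \<Longrightarrow> meager (closure W - W)"
proof (rule meager_nowhere_dense)
  assume W: "open W"
  show "closed (closure W - W)" using W by (simp add: closed_Diff)
  show "interior (closure W - W) = {}"
  proof -
    have "interior (closure W - W) \<inter> W = {}" using interior_subset by blast
    then have "interior (closure W - W) \<inter> closure W = {}"
      by (simp add: open_Int_closure_eq_empty)
    then show ?thesis using interior_subset by blast
  qed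
qed

lemma Baire_open_not_meager:
  fixes G :: "'a::topological_space set"
  assumes "compact (UNIV :: 'a set)" "Hausdorff_space (euclidean :: 'a topology)" "open G" "G \<noteq> {}"
  shows "\<not> meager G"
proof
  assume "meager G"
  then obtain F :: "nat \<Rightarrow> 'a set" where F: "\<And>n. closed (F n) \<and> interior (F n) = {}" "G \<subseteq> (\<Union>n. F n)"
    unfolding meager_def by blast
  have "compact_space (euclidean :: 'a topology)"
    using assms(1) by (simp add: compact_space_def)
  then have "locally_compact_space (euclidean :: 'a topology) \<and> regular_space (euclidean :: 'a topology)"
    using assms(2) compact_Hausdorff_imp_regular_space compact_imp_locally_compact_space by blast
  then have "(euclidean :: 'a topology) interior_of \<Union>(range F) = {}"
    by (intro Baire_category_alt) (use F in auto)
  then have "interior (\<Union>n. F n) = {}" by simp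
  then show False using F(2) assms interior_maximal by blast
qed

text \<open>The least closed set that contains \<open>B\<close> up to a meager set.\<close>

definition category_hull :: "'a::topological_space set \<Rightarrow> 'a set" where
  "category_hull B = - \<Union>{G. open G \<and> meager (G \<inter> B)}"

lemma closed_category_hull: "closed (category_hull B)"
  unfolding category_hull_def by (intro closed_Compl open_Union) auto

lemma category_hull_subset_closure: "category_hull B \<subseteq> closure B"
proof -
  have "- closure B \<in> {G. open G \<and> meager (G \<inter> B)}"
  proof -
    have "- closure B \<inter> B = {}" using closure_subset[of B] by blast
    then show ?thesis using meager_empty by (simp add: open_Compl)
  qed
  then show ?thesis unfolding category_hull_def by blast
qed

text \<open>A countable basis replaces the arbitrary union of open sets in which \<open>B\<close> is
  meager by a countable one.\<close>

lemma meager_minus_category_hull: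
  fixes B :: "'a::second_countable_topology set"
  shows "meager (B - category_hull B)"
proof -
  obtain \<B> :: "'a set set" where \<B>: "countable \<B>" "topological_basis \<B>"
    using ex_countable_basis by blast
  let ?I = "{G \<in> \<B>. meager (G \<inter> B)}"
  have "meager (\<Union>G\<in>?I. G \<inter> B)"
    using \<B>(1) by (intro meager_UN) (auto intro: countable_subset)
  moreover have "B - category_hull B \<subseteq> (\<Union>G\<in>?I. G \<inter> B)"
  proof
    fix x assume "x \<in> B - category_hull B"
    then obtain U where U: "open U" "meager (U \<inter> B)" "x \<in> U" "x \<in> B"
      unfolding category_hull_def by blast
    then obtain G where "G \<in> \<B>" "x \<in> G" "G \<subseteq> U"
      using topological_basisE[OF \<B>(2)] by metis
    then show "x \<in> (\<Union>G\<in>?I. G \<inter> B)"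
      using U meager_subset[of "U \<inter> B" "G \<inter> B"] by blast
  qed
  ultimately show ?thesis by (rule meager_subset)
qed

text \<open>Up to a meager set, \<open>B n\<close> lies in its hull and even in the interior of its
  hull. Hence \<open>P\<close> is meager in the open set \<open>?G\<close> that these interiors
  leave over, so the hull of \<open>P\<close> avoids \<open>?G\<close>. As \<open>?G\<close> is part
  of that hull, it is empty.\<close>

lemma meager_category_hull_UN:
  fixes B :: "nat \<Rightarrow> 'a::second_countable_topology set"
  assumes "P \<subseteq> (\<Union>n. B n)"
  shows "meager (category_hull P - (\<Union>n. category_hull (B n)))"
proof -
  let ?H = "category_hull P" and ?W = "\<Union>n. interior (category_hull (B n))"
  let ?G = "interior ?H - closure ?W"
  have "meager (\<Union>n. (B n - category_hull (B n)) \<union> (category_hull (B n) - interior (category_hull (B n))))"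
    by (intro meager_UN_nat meager_Un meager_minus_category_hull meager_closed_minus_interior
        closed_category_hull)
  moreover have "?G \<inter> P \<subseteq> (\<Union>n. (B n - category_hull (B n)) \<union> (category_hull (B n) - interior (category_hull (B n))))"
    using assms closure_subset[of ?W] by blast
  ultimately have "meager (?G \<inter> P)" by (rule meager_subset)
  moreover have "open ?G" by (simp add: open_Diff)
  ultimately have "?G \<inter> ?H = {}" unfolding category_hull_def by blast
  then have "interior ?H \<subseteq> closure ?W" using interior_subset by blast
  moreover have "?W \<subseteq> (\<Union>n. category_hull (B n))" using interior_subset by blast
  ultimately have "?H - (\<Union>n. category_hull (B n)) \<subseteq> (?H - interior ?H) \<union> (closure ?W - ?W)"
    by blast
  moreover have "meager ((?H - interior ?H) \<union> (closure ?W - ?W))"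
    by (intro meager_Un meager_closed_minus_interior meager_closure_minus_open closed_category_hull)
      auto
  ultimately show ?thesis by (rule meager_subset[rotated])
qed

text \<open>The classical argument that the Souslin operation preserves the Baire property. Over the
  countably many finite sequences the defects of the hulls add up to a meager set \<open>M\<close>.
  A point of \<open>category_hull (P [])\<close> outside \<open>M\<close> can always be pushed one
  level deeper, so it follows a whole branch of closures and lands in \<open>P []\<close>.\<close>

lemma Souslin_nonmeager_comeager_open:
  fixes P :: "nat list \<Rightarrow> 'a::second_countable_topology set"
  assumes step: "\<And>s. P s \<subseteq> (\<Union>n. P (s @ [n]))"
    and branch: "\<And>y. (\<Inter>n. closure (P (map y [0..<n]))) \<subseteq> P []"
    and nm: "\<not> meager (P [])"
  obtains G where "open G" "G \<noteq> {}" "meager (G - P [])"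
proof
  define M where "M = (\<Union>s. category_hull (P s) - (\<Union>n. category_hull (P (s @ [n]))))"
  have "meager M"
    unfolding M_def by (intro meager_UN meager_category_hull_UN step) auto
  have "category_hull (P []) - M \<subseteq> P []"
  proof
    fix x assume x: "x \<in> category_hull (P []) - M"
    define g where "g s = (SOME n. x \<in> category_hull (P (s @ [n])))" for s
    have g: "x \<in> category_hull (P (s @ [g s]))" if "x \<in> category_hull (P s)" for s
    proof -
      have "\<exists>n. x \<in> category_hull (P (s @ [n]))" using x that by (auto simp: M_def)
      then show ?thesis unfolding g_def by (rule someI_ex)
    qed
    define t where "t = rec_nat [] (\<lambda>_ s. s @ [g s])"
    have t: "t 0 = []" "t (Suc n) = t n @ [g (t n)]" for n by (simp_all add: t_def)
    have "t n = map (\<lambda>k. g (t k)) [0..<n]" for n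
      by (induction n) (simp_all add: t)
    moreover have "x \<in> category_hull (P (t n))" for n
      by (induction n) (use x g in \<open>simp_all add: t\<close>)
    ultimately have "x \<in> category_hull (P (map (\<lambda>k. g (t k)) [0..<n]))" for n by metis
    then have "x \<in> (\<Inter>n. closure (P (map (\<lambda>k. g (t k)) [0..<n])))"
      using category_hull_subset_closure by blast
    then show "x \<in> P []" using branch by blast
  qed
  then have *: "category_hull (P []) - P [] \<subseteq> M" by blast
  let ?G = "interior (category_hull (P []))"
  show "open ?G" by simp
  show "meager (?G - P [])"
    using \<open>meager M\<close> by (rule meager_subset) (use * interior_subset in blast)
  show "?G \<noteq> {}"
  proof
    assume "?G = {}"
    then have "meager (category_hull (P []))"
      by (simp add: meager_nowhere_dense closed_category_hull)
    then have "meager (category_hull (P []) \<union> (P [] - category_hull (P [])))"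
      by (intro meager_Un meager_minus_category_hull)
    then show False using nm meager_subset by blast
  qed
qed

section \<open>Projections along compact sets\<close>

lemma compact_functions_into:
  fixes K :: "'b::topological_space set"
  assumes "compact K"
  shows "compact {w :: 'a \<Rightarrow> 'b. \<forall>i. w i \<in> K}"
proof -
  have "compactin (product_topology (\<lambda>_ :: 'a. euclidean) UNIV) (PiE UNIV (\<lambda>_. K))"
    using assms by (simp add: compactin_PiE)
  moreover have "PiE UNIV (\<lambda>_. K) = {w :: 'a \<Rightarrow> 'b. \<forall>i. w i \<in> K}"
    by (auto simp: PiE_UNIV_domain)
  ultimately show ?thesis
    by (simp add: euclidean_product_topology)
qed

lemma closed_projection_along_compact:
  fixes G :: "('a::topological_space \<times> 'b::topological_space) set"
  assumes "compact K" "closed G"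
  shows "closed {x. \<exists>w\<in>K. (x, w) \<in> G}"
proof -
  have "compact_space (top_of_set K)"
    using assms(1) by (simp add: compact_space_subtopology)
  then have "closed_map (prod_topology (euclidean :: 'a topology) (top_of_set K)) euclidean fst"
    by (rule closed_map_fst)
  moreover have "closedin (prod_topology (euclidean :: 'a topology) (top_of_set K)) ((UNIV \<times> K) \<inter> G)"
    using closedin_closed_Int[OF assms(2), of "UNIV \<times> K"]
    by (simp add: prod_topology_subtopology(2))
  ultimately have "closed (fst ` ((UNIV \<times> K) \<inter> G))"
    by (simp add: closed_map_def)
  moreover have "fst ` ((UNIV \<times> K) \<inter> G) = {x. \<exists>w\<in>K. (x, w) \<in> G}"
    by force
  ultimately show ?thesis by simp
qed

lemma projection_nonmeager_comeager_open:
  fixes F :: "nat \<Rightarrow> nat \<Rightarrow> ('a::second_countable_topology \<times> 'b::topological_space) set"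
  assumes K: "compact K" and F: "\<And>k m. closed (F k m)"
    and A: "A = {x. \<exists>w\<in>K. \<forall>k. \<exists>m. (x, w) \<in> F k m}" and nm: "\<not> meager A"
  obtains G where "open G" "G \<noteq> {}" "meager (G - A)"
proof -
  \<comment> \<open>A finite sequence records the disjuncts chosen so far. The second conjunct keeps
    \<open>w\<close> a full witness, so that a next choice always exists.\<close>
  define P where
    "P s = {x. \<exists>w\<in>K. (\<forall>k<length s. (x, w) \<in> F k (s ! k)) \<and> (\<forall>k. \<exists>m. (x, w) \<in> F k m)}" for s
  have P0: "P [] = A" by (simp add: P_def A)
  show ?thesis
  proof (rule Souslin_nonmeager_comeager_open[of P])
    show "P s \<subseteq> (\<Union>n. P (s @ [n]))" for s
    proof
      fix x assume "x \<in> P s"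
      then obtain w where w: "w \<in> K" "\<forall>k<length s. (x, w) \<in> F k (s ! k)" "\<forall>k. \<exists>m. (x, w) \<in> F k m"
        unfolding P_def by blast
      then obtain m where "(x, w) \<in> F (length s) m" by blast
      then have "x \<in> P (s @ [m])"
        unfolding P_def using w by (auto simp: nth_append less_Suc_eq intro!: bexI[of _ w])
      then show "x \<in> (\<Union>n. P (s @ [n]))" by blast
    qed
    show "(\<Inter>n. closure (P (map y [0..<n]))) \<subseteq> P []" for y
    proof
      fix x assume x: "x \<in> (\<Inter>n. closure (P (map y [0..<n])))"
      \<comment> \<open>Passing to closures may destroy the second conjunct of \<open>P\<close>, but
        the finitely many closed conditions survive because their projection along \<open>K\<close>
        is closed. Compactness then merges the witnesses for all \<open>n\<close> into one.\<close>
      have approx: "\<exists>w\<in>K. \<forall>k<n. (x, w) \<in> F k (y k)" for n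
      proof -
        let ?Q = "{x. \<exists>w\<in>K. (x, w) \<in> (\<Inter>k\<in>{..<n}. F k (y k))}"
        have "closed ?Q"
          by (rule closed_projection_along_compact) (use K F in auto)
        moreover have "P (map y [0..<n]) \<subseteq> ?Q"
        proof
          fix z assume "z \<in> P (map y [0..<n])"
          then obtain w where "w \<in> K" "\<forall>k<n. (z, w) \<in> F k (map y [0..<n] ! k)"
            unfolding P_def by auto
          then show "z \<in> ?Q" by (intro CollectI bexI[of _ w]) auto
        qed
        ultimately have "closure (P (map y [0..<n])) \<subseteq> ?Q" by (rule closure_minimal[rotated])
        moreover have "x \<in> closure (P (map y [0..<n]))" using x by (rule INT_D) simp
        ultimately have "x \<in> ?Q" by (rule subsetD)
        then show ?thesis by auto
      qed
      have "K \<inter> \<Inter>(range (\<lambda>k. {w. (x, w) \<in> F k (y k)})) \<noteq> {}"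
      proof (rule compact_imp_fip[OF K])
        fix T assume "T \<in> range (\<lambda>k. {w. (x, w) \<in> F k (y k)})"
        then obtain k where "T = (\<lambda>w. (x, w)) -` F k (y k)" by auto
        moreover have "closed ((\<lambda>w. (x, w)) -` F k (y k))"
          by (intro closed_vimage F continuous_intros)
        ultimately show "closed T" by simp
      next
        fix F' assume "finite F'" "F' \<subseteq> range (\<lambda>k. {w. (x, w) \<in> F k (y k)})"
        then obtain J where J: "finite J" "F' = (\<lambda>k. {w. (x, w) \<in> F k (y k)}) ` J"
          by (meson finite_subset_image)
        then obtain n where "J \<subseteq> {..<n}"
          using finite_nat_iff_bounded by blast
        moreover obtain w where "w \<in> K" "\<forall>k<n. (x, w) \<in> F k (y k)" using approx by blast
        ultimately have "w \<in> K \<inter> \<Inter>F'" using J(2) by auto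
        then show "K \<inter> \<Inter>F' \<noteq> {}" by blast
      qed
      then obtain w where "w \<in> K" "\<forall>k. (x, w) \<in> F k (y k)" by auto
      then show "x \<in> P []" unfolding P_def by auto
    qed
  qed (use P0 nm that in auto)
qed

section \<open>Clopen subsets of compact spaces\<close>

definition clopen_in :: "'a::topological_space set \<Rightarrow> 'a set \<Rightarrow> bool" where
  "clopen_in K D \<longleftrightarrow> D \<subseteq> K \<and> closed D \<and> closed (K - D)"

lemma clopen_in_Diff: "clopen_in K D \<Longrightarrow> clopen_in K (K - D)"
  by (auto simp: clopen_in_def double_diff)

lemma clopen_in_whole: "closed K \<Longrightarrow> clopen_in K K"
  by (simp add: clopen_in_def)

lemma clopen_in_Int: "clopen_in K D \<Longrightarrow> clopen_in K E \<Longrightarrow> clopen_in K (D \<inter> E)"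
  by (auto simp: clopen_in_def Diff_Int)

lemma clopen_in_finite_Inter:
  assumes "finite \<F>" "\<F> \<noteq> {}" "\<And>D. D \<in> \<F> \<Longrightarrow> clopen_in K D"
  shows "clopen_in K (\<Inter>\<F>)"
  using assms by (induction rule: finite_ne_induct) (auto intro: clopen_in_Int)

lemma clopen_in_connected:
  assumes D: "clopen_in K D" and C: "connected C" "C \<subseteq> K" "x \<in> C" "x \<in> D"
  shows "C \<subseteq> D"
proof (rule ccontr)
  assume "\<not> C \<subseteq> D"
  then have "(K - D) \<inter> C \<noteq> {}" using C by blast
  moreover have "D \<inter> C \<noteq> {}" using C by blast
  moreover have "C \<subseteq> D \<union> (K - D)" "D \<inter> (K - D) \<inter> C = {}" using C by auto
  ultimately show False
    using C(1) D unfolding clopen_in_def connected_closed by blast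
qed

text \<open>A clopen set is compact, hence cut out of \<open>K\<close> by finitely many basis
  sets.\<close>

lemma countable_clopen_in:
  fixes K :: "'a::second_countable_topology set"
  assumes K: "compact K"
  shows "countable {D. clopen_in K D}"
proof -
  obtain \<B> :: "'a set set" where \<B>: "countable \<B>" "topological_basis \<B>"
    using ex_countable_basis by blast
  have "{D. clopen_in K D} \<subseteq> (\<lambda>\<F>. K \<inter> \<Union>\<F>) ` {\<F>. finite \<F> \<and> \<F> \<subseteq> \<B>}"
  proof
    fix D assume "D \<in> {D. clopen_in K D}"
    then have D: "D \<subseteq> K" "closed D" "open (- (K - D))" unfolding clopen_in_def by (auto simp del: Compl_Diff_eq)
    obtain \<G> where \<G>: "\<G> \<subseteq> \<B>" "\<Union>\<G> = - (K - D)"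
      using \<B>(2) D(3) unfolding topological_basis_def by blast
    have "compact D" using D(1,2) K by (metis compact_Int_closed inf.absorb_iff2)
    moreover have "D \<subseteq> \<Union>\<G>" using \<G> D by blast
    moreover have "\<And>B. B \<in> \<G> \<Longrightarrow> open B" using \<G>(1) \<B>(2) topological_basis_open by blast
    ultimately obtain \<F> where \<F>: "\<F> \<subseteq> \<G>" "finite \<F>" "D \<subseteq> \<Union>\<F>"
      by (meson compactE)
    then have "\<Union>\<F> \<subseteq> - (K - D)" using \<G>(2) by blast
    then have "D = K \<inter> \<Union>\<F>" using \<F>(3) D(1) by blast
    then show "D \<in> (\<lambda>\<F>. K \<inter> \<Union>\<F>) ` {\<F>. finite \<F> \<and> \<F> \<subseteq> \<B>}"
      using \<F> \<G>(1) by blast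
  qed
  moreover have "countable {\<F>. finite \<F> \<and> \<F> \<subseteq> \<B>}"
    using \<B>(1) by (rule countable_Collect_finite_subset)
  ultimately show ?thesis
    by (meson countable_image countable_subset)
qed

text \<open>The quasi-component of a point is its component; the library states this result of Sura-Bura
  for Euclidean spaces only.\<close>

lemma clopen_in_neighbourhood_of_quasi_component:
  fixes K :: "'a::t2_space set"
  assumes K: "compact K" and W: "open W" "\<Inter>{D. clopen_in K D \<and> x \<in> D} \<subseteq> W" and x: "x \<in> K"
  obtains D where "clopen_in K D" "x \<in> D" "D \<subseteq> W"
proof -
  let ?T = "{D. clopen_in K D \<and> x \<in> D}"
  have KT: "K \<in> ?T" using K x by (simp add: clopen_in_whole compact_imp_closed)
  have "(K - W) \<inter> Q = {}" if "Q \<subseteq> W" for Q using that by blast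
  from this[OF W(2)] have "(K - W) \<inter> \<Inter>?T = {}" .
  moreover have "compact (K - W)" using K W by (simp add: compact_diff)
  moreover have "\<And>D. D \<in> ?T \<Longrightarrow> closed D" by (simp add: clopen_in_def)
  ultimately obtain \<F> where \<F>: "finite \<F>" "\<F> \<subseteq> ?T" "(K - W) \<inter> \<Inter>\<F> = {}"
    using compact_imp_fip[of "K - W" ?T] by metis
  show ?thesis
  proof
    show "clopen_in K (\<Inter>(insert K \<F>))"
      using \<F> KT by (intro clopen_in_finite_Inter) auto
    show "x \<in> \<Inter>(insert K \<F>)" using \<F>(2) x by auto
    show "\<Inter>(insert K \<F>) \<subseteq> W" using \<F>(3) by auto
  qed
qed

lemma connected_quasi_component:
  fixes K :: "'a::t4_space set"
  assumes K: "compact K" and x: "x \<in> K"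
  shows "connected (\<Inter>{D. clopen_in K D \<and> x \<in> D})"
proof -
  define Q where "Q = \<Inter>{D. clopen_in K D \<and> x \<in> D}"
  have clQ: "closed Q" unfolding Q_def by (intro closed_Inter) (auto simp: clopen_in_def)
  have K': "closed K" using K by (rule compact_imp_closed)
  have xQ: "x \<in> Q" by (auto simp: Q_def)
  have empty: "K2 = {}"
    if K12: "closed K1" "closed K2" "K1 \<inter> K2 = {}" "Q = K1 \<union> K2" and xK1: "x \<in> K1" for K1 K2
  proof -
    obtain V1 V2 where V: "open V1" "open V2" "K1 \<subseteq> V1" "K2 \<subseteq> V2" "V1 \<inter> V2 = {}"
      using t4_space[OF K12(1-3)] by blast
    then have "open (V1 \<union> V2)" "Q \<subseteq> V1 \<union> V2" using K12 by auto
    then obtain D where D: "clopen_in K D" "x \<in> D" "D \<subseteq> V1 \<union> V2"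
      unfolding Q_def by (rule clopen_in_neighbourhood_of_quasi_component[OF K _ _ x])
    \<comment> \<open>Inside \<open>D\<close> the open sets \<open>V1\<close> and \<open>V2\<close>
      are complementary, so the part of \<open>D\<close> in \<open>V1\<close> is again clopen and
      must contain all of \<open>Q\<close>.\<close>
    have eq: "D \<inter> V1 = D - V2" "K - (D \<inter> V1) = (K - D) \<union> (D - V1)"
      using D V by (auto simp: clopen_in_def)
    have "clopen_in K (D \<inter> V1)"
      unfolding clopen_in_def
    proof (intro conjI)
      show "D \<inter> V1 \<subseteq> K" using D by (auto simp: clopen_in_def)
      show "closed (D \<inter> V1)" unfolding eq(1) using D V by (simp add: clopen_in_def closed_Diff)
      show "closed (K - (D \<inter> V1))" unfolding eq(2) using D V by (simp add: clopen_in_def closed_Diff closed_Un)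
    qed
    moreover have "x \<in> D \<inter> V1" using xK1 D V by blast
    ultimately have "Q \<subseteq> D \<inter> V1" unfolding Q_def by (intro Inter_lower) simp
    then have "K1 \<union> K2 \<subseteq> D \<inter> V1" by (simp only: K12(4))
    then show "K2 = {}" using V by blast
  qed
  have "connected Q"
    unfolding connected_closed
  proof clarify
    fix A B assume AB: "closed A" "closed B" "Q \<subseteq> A \<union> B" "A \<inter> B \<inter> Q = {}"
      and ne: "A \<inter> Q \<noteq> {}" "B \<inter> Q \<noteq> {}"
    have cl: "closed (A \<inter> Q)" "closed (B \<inter> Q)" using AB clQ by (simp_all add: closed_Int)
    have dj: "(A \<inter> Q) \<inter> (B \<inter> Q) = {}" "(B \<inter> Q) \<inter> (A \<inter> Q) = {}" using AB by blast+
    have un: "Q = (A \<inter> Q) \<union> (B \<inter> Q)" "Q = (B \<inter> Q) \<union> (A \<inter> Q)" using AB by blast+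
    have "x \<in> A \<inter> Q \<or> x \<in> B \<inter> Q" using xQ AB(3) by blast
    then show False
      using empty[OF cl dj(1) un(1)] empty[OF cl(2,1) dj(2) un(2)] ne by blast
  qed
  then show ?thesis by (simp only: Q_def)
qed

text \<open>This makes clopen sets fine enough to detect components. It separates two components,
  and it supplies the small neighbourhoods that the last condition of
  \<open>homeomorphism_code\<close> asks for.\<close>

lemma component_clopen_in_neighbourhood:
  fixes K :: "'a::t4_space set"
  assumes K: "compact K" and C: "C \<in> components K" and V: "open V" "C \<subseteq> V"
  obtains D where "clopen_in K D" "C \<subseteq> D" "D \<subseteq> V"
proof -
  obtain x where x: "x \<in> C" using C in_components_nonempty by blast
  have CK: "C \<subseteq> K" "connected C" using C in_components_subset in_components_connected by blast+
  let ?Q = "\<Inter>{D. clopen_in K D \<and> x \<in> D}"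
  have "?Q \<subseteq> K"
    using K CK x by (intro Inter_lower) (auto simp: clopen_in_whole compact_imp_closed)
  moreover have "connected ?Q" using connected_quasi_component K CK x by blast
  ultimately have "?Q \<subseteq> C" using components_maximal[OF C, of ?Q] x by blast
  then have "?Q \<subseteq> V" using V(2) by (rule subset_trans)
  then obtain D where "clopen_in K D" "x \<in> D" "D \<subseteq> V"
    using clopen_in_neighbourhood_of_quasi_component[OF K V(1)] CK x by blast
  then show ?thesis using that clopen_in_connected CK x by blast
qed

lemma components_separated_by_clopen_in:
  fixes K :: "'a::t4_space set"
  assumes K: "compact K" and C: "C \<in> components K" "C' \<in> components K" "C \<noteq> C'"
  obtains D where "clopen_in K D" "C \<subseteq> D" "C' \<subseteq> K - D"
proof -
  have "C \<inter> C' = {}" using C components_nonoverlap by blast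
  have "closed C'" using closed_components[OF compact_imp_closed[OF K] C(2)] .
  obtain D where D: "clopen_in K D" "C \<subseteq> D" "D \<subseteq> - C'"
    by (rule component_clopen_in_neighbourhood[OF K C(1), of "- C'"])
      (use \<open>closed C'\<close> \<open>C \<inter> C' = {}\<close> in auto)
  then show ?thesis using that C(2) in_components_subset by blast
qed

section \<open>Spaces homeomorphic to a component form an analytic family\<close>

lemma uniform_extension_to_closure:
  fixes e :: "nat \<Rightarrow> 'p::metric_space" and w :: "nat \<Rightarrow> 'b::complete_space"
  assumes "\<And>\<epsilon>. \<epsilon> > 0 \<Longrightarrow> \<exists>\<delta>>0. \<forall>i j. dist (e i) (e j) < \<delta> \<longrightarrow> dist (w i) (w j) < \<epsilon>"
  obtains f where "continuous_on (closure (range e)) f" "\<And>i. f (e i) = w i"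
    "f ` closure (range e) \<subseteq> closure (range w)"
proof -
  \<comment> \<open>The sequence \<open>e\<close> may repeat points, as \<open>ray_point\<close>
    does. The uniformity assumption makes \<open>w\<close> respect the repetitions.\<close>
  have eq: "w i = w j" if "e i = e j" for i j
  proof (rule ccontr)
    assume "w i \<noteq> w j"
    then have "dist (w i) (w j) > 0" by simp
    then show False using assms[of "dist (w i) (w j)"] that by force
  qed
  define f0 where "f0 p = w (SOME i. e i = p)" for p
  have f0: "f0 (e i) = w i" for i
    unfolding f0_def by (rule eq) (rule someI[of _ i], rule refl)
  have "uniformly_continuous_on (range e) f0"
    unfolding uniformly_continuous_on_def
  proof (intro allI impI)
    fix \<epsilon> :: real assume "\<epsilon> > 0"
    then obtain \<delta> where "\<delta> > 0" "\<forall>i j. dist (e i) (e j) < \<delta> \<longrightarrow> dist (w i) (w j) < \<epsilon>"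
      using assms by blast
    then show "\<exists>d>0. \<forall>x\<in>range e. \<forall>x'\<in>range e. dist x' x < d \<longrightarrow> dist (f0 x') (f0 x) < \<epsilon>"
      using f0 by (intro exI[of _ \<delta>]) auto
  qed
  then obtain f where f: "uniformly_continuous_on (closure (range e)) f" "\<And>p. p \<in> range e \<Longrightarrow> f0 p = f p"
    using uniformly_continuous_on_extension_on_closure[of "range e" f0] by metis
  have cont: "continuous_on (closure (range e)) f"
    using f(1) by (rule uniformly_continuous_imp_continuous)
  have fe: "f (e i) = w i" for i using f(2)[of "e i"] f0 by simp
  have "f ` closure (range e) \<subseteq> closure (range w)"
    by (rule image_closure_subset[OF cont])
      (use fe closure_subset[of "range w"] in auto)
  then show ?thesis using that cont fe by blast
qed

lemma homeomorphic_closures: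
  fixes e :: "nat \<Rightarrow> 'p::complete_space" and w :: "nat \<Rightarrow> 'b::complete_space"
  assumes ew: "\<And>\<epsilon>. \<epsilon> > 0 \<Longrightarrow> \<exists>\<delta>>0. \<forall>i j. dist (e i) (e j) < \<delta> \<longrightarrow> dist (w i) (w j) < \<epsilon>"
    and we: "\<And>\<epsilon>. \<epsilon> > 0 \<Longrightarrow> \<exists>\<delta>>0. \<forall>i j. dist (w i) (w j) < \<delta> \<longrightarrow> dist (e i) (e j) < \<epsilon>"
  shows "closure (range e) homeomorphic closure (range w)"
proof -
  obtain f where f: "continuous_on (closure (range e)) f" "\<And>i. f (e i) = w i"
    "f ` closure (range e) \<subseteq> closure (range w)"
    using uniform_extension_to_closure[OF ew] by metis
  obtain g where g: "continuous_on (closure (range w)) g" "\<And>i. g (w i) = e i"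
    "g ` closure (range w) \<subseteq> closure (range e)"
    using uniform_extension_to_closure[OF we] by metis
  have gf: "dist (g (f p)) p = 0" if "p \<in> closure (range e)" for p
  proof (rule continuous_constant_on_closure[OF _ _ that])
    show "continuous_on (closure (range e)) (\<lambda>p. dist (g (f p)) p)"
      by (intro continuous_intros continuous_on_compose2[OF g(1) f(1) f(3)])
  qed (use f(2) g(2) in auto)
  have fg: "dist (f (g p)) p = 0" if "p \<in> closure (range w)" for p
  proof (rule continuous_constant_on_closure[OF _ _ that])
    show "continuous_on (closure (range w)) (\<lambda>p. dist (f (g p)) p)"
      by (intro continuous_intros continuous_on_compose2[OF f(1) g(1) g(3)])
  qed (use f(2) g(2) in auto)
  show ?thesis
    unfolding homeomorphic_minimal
    using f(1,3) g(1,3) gf fg by (intro exI[of _ f] exI[of _ g]) (auto simp: image_subset_iff)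
qed

lemma homeomorphism_uniform_correspondence:
  fixes e :: "nat \<Rightarrow> 'p::metric_space" and h :: "'p \<Rightarrow> 'b::metric_space"
  assumes "compact S" "continuous_on S h" "range e \<subseteq> S" "\<epsilon> > 0"
  shows "\<exists>\<delta>>0. \<forall>i j. dist (e i) (e j) < \<delta> \<longrightarrow> dist (h (e i)) (h (e j)) < \<epsilon>"
  using compact_uniformly_continuous[OF assms(2,1)] assms(3,4)
  unfolding uniformly_continuous_on_def by (metis range_subsetD)

text \<open>A homeomorphism from \<open>closure (range e)\<close> is encoded by its values at the points \<open>e i\<close>, so that
  the possible homeomorphisms into a compact set \<open>U\<close> range over the compact space of sequences
  in \<open>U\<close>. Each condition on such a sequence is a countable conjunction of countable disjunctions of
  closed conditions.\<close>

definition homeomorphism_code ::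
    "('a \<Rightarrow> nat \<Rightarrow> 'p::metric_space) \<Rightarrow> (nat \<Rightarrow> 'b::metric_space set) \<Rightarrow> nat \<Rightarrow> nat \<Rightarrow>
     ('a \<times> (nat \<Rightarrow> 'b)) set" where
  "homeomorphism_code E D k m = (case from_nat m of (a :: nat, b :: nat, n :: nat, N :: nat) \<Rightarrow>
     {z. \<forall>i j. inverse (Suc a) \<le> dist (E (fst z) i) (E (fst z) j) \<or> dist (snd z i) (snd z j) \<le> inverse (Suc k)} \<inter>
     {z. \<forall>i j. inverse (Suc b) \<le> dist (snd z i) (snd z j) \<or> dist (E (fst z) i) (E (fst z) j) \<le> inverse (Suc k)} \<inter>
     {z. \<forall>i. snd z i \<in> D n} \<inter>
     {z. \<forall>p\<in>D n. \<exists>i\<in>{..N}. dist p (snd z i) \<le> inverse (Suc k)})"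

text \<open>Two features of the code serve this lemma: all inequalities are weak, and the index
  \<open>i\<close> in the density condition is bounded by \<open>N\<close>, which turns an infinite
  union into a finite one.\<close>

lemma closed_homeomorphism_code:
  fixes E :: "'a::topological_space \<Rightarrow> nat \<Rightarrow> 'p::metric_space"
    and D :: "nat \<Rightarrow> 'b::metric_space set"
  assumes E: "\<And>i. continuous_on UNIV (\<lambda>x. E x i)" and D: "\<And>n. closed (D n)"
  shows "closed (homeomorphism_code E D k m)"
proof -
  have E': "continuous_on UNIV (\<lambda>z :: 'a \<times> (nat \<Rightarrow> 'b). E (fst z) i)" for i
    by (rule continuous_on_compose2[OF E[of i]]) (auto intro: continuous_intros)
  have W: "continuous_on UNIV (\<lambda>z :: 'a \<times> (nat \<Rightarrow> 'b). snd z i)" for i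
    by (rule continuous_on_product_then_coordinatewise) (auto intro: continuous_intros)
  have dE: "continuous_on UNIV (\<lambda>z :: 'a \<times> (nat \<Rightarrow> 'b). dist (E (fst z) i) (E (fst z) j))"
    and dW: "continuous_on UNIV (\<lambda>z :: 'a \<times> (nat \<Rightarrow> 'b). dist (snd z i) (snd z j))"
    and dp: "continuous_on UNIV (\<lambda>z :: 'a \<times> (nat \<Rightarrow> 'b). dist p (snd z i))" for i j p
    by (intro continuous_intros E' W)+
  have 1: "closed {z :: 'a \<times> (nat \<Rightarrow> 'b). \<forall>i j. r \<le> dist (E (fst z) i) (E (fst z) j) \<or> dist (snd z i) (snd z j) \<le> s}"
    and 2: "closed {z :: 'a \<times> (nat \<Rightarrow> 'b). \<forall>i j. r \<le> dist (snd z i) (snd z j) \<or> dist (E (fst z) i) (E (fst z) j) \<le> s}" for r s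
    by (intro closed_Collect_all closed_Collect_disj closed_Collect_le dE dW continuous_on_const)+
  have 3: "closed {z :: 'a \<times> (nat \<Rightarrow> 'b). \<forall>i. snd z i \<in> D n}" for n
  proof (intro closed_Collect_all)
    fix i
    have "closed ((\<lambda>z :: 'a \<times> (nat \<Rightarrow> 'b). snd z i) -` D n)"
      by (rule closed_vimage[OF D W])
    then show "closed {z :: 'a \<times> (nat \<Rightarrow> 'b). snd z i \<in> D n}" by (simp add: vimage_def)
  qed
  have 4: "closed {z :: 'a \<times> (nat \<Rightarrow> 'b). \<forall>p\<in>D n. \<exists>i\<in>{..N}. dist p (snd z i) \<le> s}" for n N s
  proof -
    have "{z :: 'a \<times> (nat \<Rightarrow> 'b). \<forall>p\<in>D n. \<exists>i\<in>{..N}. dist p (snd z i) \<le> s} =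
      (\<Inter>p\<in>D n. \<Union>i\<in>{..N}. {z. dist p (snd z i) \<le> s})" by auto
    moreover have "closed (\<Inter>p\<in>D n. \<Union>i\<in>{..N}. {z :: 'a \<times> (nat \<Rightarrow> 'b). dist p (snd z i) \<le> s})"
      by (intro closed_INT ballI closed_UN finite_atMost closed_Collect_le dp continuous_on_const)
    ultimately show ?thesis by simp
  qed
  show ?thesis
    unfolding homeomorphism_code_def
    by (cases "from_nat m :: nat \<times> nat \<times> nat \<times> nat") (simp add: closed_Int 1 2 3 4)
qed

text \<open>The last two conditions of the code ensure that the image is a whole component and not
  just a subcontinuum of one: a larger connected set stays inside the clopen set \<open>D n\<close>,
  where every point is within \<open>inverse (Suc k)\<close> of the sequence.\<close>

lemma component_range_closure:
  fixes K :: "'b::metric_space set" and w :: "nat \<Rightarrow> 'b"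
  assumes D: "\<And>n. clopen_in K (D n)" and conn: "connected (closure (range w))"
    and *: "\<And>k. \<exists>n. range w \<subseteq> D n \<and> (\<forall>p\<in>D n. \<exists>i. dist p (w i) \<le> inverse (Suc k))"
  shows "closure (range w) \<in> components K"
  unfolding in_components_maximal
proof (intro conjI allI impI conn)
  show "closure (range w) \<noteq> {}" by simp
  have sub: "closure (range w) \<subseteq> D n" if "range w \<subseteq> D n" for n
    using closure_minimal[OF that] D[of n] by (simp add: clopen_in_def)
  then show "closure (range w) \<subseteq> K" using *[of 0] D unfolding clopen_in_def by blast
  fix C' assume C': "C' \<noteq> {} \<and> closure (range w) \<subseteq> C' \<and> C' \<subseteq> K \<and> connected C'"
  have "C' \<subseteq> closure (range w)"
  proof
    fix p assume p: "p \<in> C'"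
    show "p \<in> closure (range w)"
      unfolding closure_approachable
    proof (intro allI impI)
      fix \<epsilon> :: real assume "\<epsilon> > 0"
      then obtain k where k: "inverse (Suc k) < \<epsilon>" using reals_Archimedean by blast
      obtain n where n: "range w \<subseteq> D n" "\<forall>p\<in>D n. \<exists>i. dist p (w i) \<le> inverse (Suc k)"
        using * by blast
      have "w 0 \<in> C'" using C' closure_subset[of "range w"] by blast
      then have "C' \<subseteq> D n"
        using clopen_in_connected[OF D[of n]] C' n(1) by blast
      then obtain i where "dist p (w i) \<le> inverse (Suc k)" using n(2) p by blast
      then show "\<exists>y\<in>range w. dist y p < \<epsilon>" using k by (auto simp: dist_commute intro: le_less_trans)
    qed
  qed
  then show "C' = closure (range w)" using C' by blast
qed

text \<open>Uniform continuity of a homeomorphism and of its inverse supplies \<open>a\<close> and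
  \<open>b\<close>, a clopen neighbourhood of the component supplies \<open>n\<close>, and
  compactness of that neighbourhood supplies \<open>N\<close>. Conversely, the code extends
  \<open>w\<close> to a homeomorphism onto \<open>closure (range w)\<close>, which is a component by
  \<open>component_range_closure\<close>.\<close>

lemma homeomorphic_component_projection:
  fixes E :: "'a::topological_space \<Rightarrow> nat \<Rightarrow> 'p::complete_space"
    and K :: "'b::complete_space set"
  assumes S: "\<And>x. compact (closure (range (E x)))" "\<And>x. connected (closure (range (E x)))"
    and K: "compact K" and U: "clopen_in K U" and D: "range D = {D. clopen_in K D}"
  shows "{x. \<exists>C\<in>components K. C \<subseteq> U \<and> closure (range (E x)) homeomorphic C} =
    {x. \<exists>w\<in>{w. \<forall>i. w i \<in> U}. \<forall>k. \<exists>m. (x, w) \<in> homeomorphism_code E D k m}"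
proof (intro Collect_cong iffI)
  have Dn: "clopen_in K (D n)" for n using D by blast
  fix x
  let ?S = "closure (range (E x))"
  {
    assume "\<exists>C\<in>components K. C \<subseteq> U \<and> ?S homeomorphic C"
    then obtain C h g where C: "C \<in> components K" "C \<subseteq> U" and hom: "homeomorphism ?S C h g"
      unfolding homeomorphic_def by blast
    define w where "w i = h (E x i)" for i
    have eS: "range (E x) \<subseteq> ?S" by (rule closure_subset)
    have hS: "continuous_on ?S h" "h ` ?S = C" "continuous_on C g" "\<And>i. g (w i) = E x i"
      using hom eS unfolding homeomorphism_def w_def by auto
    have wC: "range w \<subseteq> C" using hS(2) eS unfolding w_def by blast
    have Ccl: "compact C" using hS S(1) compact_continuous_image by metis
    have Cw: "C \<subseteq> closure (range w)"
    proof -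
      have "h ` ?S \<subseteq> closure (range w)"
        by (rule image_closure_subset[OF hS(1) closed_closure])
          (use closure_subset[of "range w"] in \<open>auto simp: w_def\<close>)
      then show ?thesis using hS(2) by simp
    qed
    have "\<exists>m. (x, w) \<in> homeomorphism_code E D k m" for k
    proof -
      let ?\<epsilon> = "inverse (real (Suc k))"
      have \<epsilon>: "?\<epsilon> > 0" by simp
      obtain \<delta> where "\<delta> > 0" and \<delta>: "\<forall>i j. dist (E x i) (E x j) < \<delta> \<longrightarrow> dist (w i) (w j) < ?\<epsilon>"
        using homeomorphism_uniform_correspondence[OF S(1) hS(1) eS \<epsilon>] unfolding w_def by blast
      then obtain a where a: "inverse (real (Suc a)) < \<delta>" using reals_Archimedean by blast
      obtain \<delta>' where "\<delta>' > 0" and \<delta>': "\<forall>i j. dist (w i) (w j) < \<delta>' \<longrightarrow> dist (E x i) (E x j) < ?\<epsilon>"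
        using homeomorphism_uniform_correspondence[OF Ccl hS(3) wC \<epsilon>] unfolding hS(4) by blast
      then obtain b where b: "inverse (real (Suc b)) < \<delta>'" using reals_Archimedean by blast
      have "C \<subseteq> (\<Union>i. ball (w i) ?\<epsilon>)"
      proof
        fix p assume "p \<in> C"
        then have "p \<in> closure (range w)" using Cw by blast
        then show "p \<in> (\<Union>i. ball (w i) ?\<epsilon>)" using \<epsilon> unfolding closure_approachable by force
      qed
      then obtain U' where U': "clopen_in K U'" "C \<subseteq> U'" "U' \<subseteq> (\<Union>i. ball (w i) ?\<epsilon>)"
        using component_clopen_in_neighbourhood[OF K C(1), of "\<Union>i. ball (w i) ?\<epsilon>"] by blast
      then obtain n where n: "U' = D n" using D by blast
      have "compact U'" using U'(1) K unfolding clopen_in_def by (metis compact_Int_closed inf.absorb_iff2)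
      then obtain J where J: "finite J" "U' \<subseteq> (\<Union>i\<in>J. ball (w i) ?\<epsilon>)"
        using compactE_image[of U' UNIV "\<lambda>i. ball (w i) ?\<epsilon>"] U'(3) by auto
      then obtain N where N: "J \<subseteq> {..N}" using finite_nat_iff_bounded_le by blast
      obtain m where m: "from_nat m = (a, b, n, N)" using surj_from_nat by (metis surjD)
      have "\<forall>i j. inverse (Suc a) \<le> dist (E x i) (E x j) \<or> dist (w i) (w j) \<le> inverse (Suc k)"
        using \<delta> a by (meson less_eq_real_def less_le_trans not_le order.strict_trans)
      moreover have "\<forall>i j. inverse (Suc b) \<le> dist (w i) (w j) \<or> dist (E x i) (E x j) \<le> inverse (Suc k)"
        using \<delta>' b by (meson less_eq_real_def less_le_trans not_le order.strict_trans)
      moreover have "\<forall>i. w i \<in> D n" using wC U'(2) n by blast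
      moreover have "\<forall>p\<in>D n. \<exists>i\<in>{..N}. dist p (w i) \<le> inverse (Suc k)"
      proof
        fix p assume "p \<in> D n"
        then obtain i where "i \<in> J" "dist (w i) p < ?\<epsilon>" using J(2) n by auto
        then show "\<exists>i\<in>{..N}. dist p (w i) \<le> inverse (Suc k)"
          using N by (intro bexI[of _ i]) (auto simp: dist_commute)
      qed
      ultimately have "(x, w) \<in> homeomorphism_code E D k m"
        unfolding homeomorphism_code_def m by simp
      then show ?thesis ..
    qed
    then show "\<exists>w\<in>{w. \<forall>i. w i \<in> U}. \<forall>k. \<exists>m. (x, w) \<in> homeomorphism_code E D k m"
      using wC C(2) by (intro bexI[of _ w]) auto
  next
    assume "\<exists>w\<in>{w. \<forall>i. w i \<in> U}. \<forall>k. \<exists>m. (x, w) \<in> homeomorphism_code E D k m"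
    then obtain w where w: "\<And>i. w i \<in> U" and code: "\<And>k. \<exists>m. (x, w) \<in> homeomorphism_code E D k m"
      by blast
    have code': "\<exists>a b n N :: nat. (\<forall>i j. inverse (Suc a) \<le> dist (E x i) (E x j) \<or> dist (w i) (w j) \<le> inverse (Suc k)) \<and>
       (\<forall>i j. inverse (Suc b) \<le> dist (w i) (w j) \<or> dist (E x i) (E x j) \<le> inverse (Suc k)) \<and>
       (\<forall>i. w i \<in> D n) \<and> (\<forall>p\<in>D n. \<exists>i\<in>{..N}. dist p (w i) \<le> inverse (Suc k))" for k
    proof -
      obtain m where m: "(x, w) \<in> homeomorphism_code E D k m" using code by blast
      obtain a b n N :: nat where abnN: "from_nat m = (a, b, n, N)" by (metis prod_cases4)
      show ?thesis
        using m unfolding homeomorphism_code_def abnN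
        by (intro exI[of _ a] exI[of _ b] exI[of _ n] exI[of _ N]) simp
    qed
    have hom: "?S homeomorphic closure (range w)"
    proof (rule homeomorphic_closures)
      fix \<epsilon> :: real assume "\<epsilon> > 0"
      then obtain k where k: "inverse (Suc k) < \<epsilon>" using reals_Archimedean by blast
      obtain a b :: nat where
        ab: "\<forall>i j. inverse (Suc a) \<le> dist (E x i) (E x j) \<or> dist (w i) (w j) \<le> inverse (Suc k)"
        "\<forall>i j. inverse (Suc b) \<le> dist (w i) (w j) \<or> dist (E x i) (E x j) \<le> inverse (Suc k)"
        using code'[of k] by blast
      show "\<exists>\<delta>>0. \<forall>i j. dist (E x i) (E x j) < \<delta> \<longrightarrow> dist (w i) (w j) < \<epsilon>"
        using ab(1) k by (intro exI[of _ "inverse (real (Suc a))"]) (simp del: of_nat_Suc, meson le_less_trans not_le)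
      show "\<exists>\<delta>>0. \<forall>i j. dist (w i) (w j) < \<delta> \<longrightarrow> dist (E x i) (E x j) < \<epsilon>"
        using ab(2) k by (intro exI[of _ "inverse (real (Suc b))"]) (simp del: of_nat_Suc, meson le_less_trans not_le)
    qed
    from this have "connected (closure (range w))"
      using S(2) homeomorphic_connectedness by blast
    moreover have "\<exists>n. range w \<subseteq> D n \<and> (\<forall>p\<in>D n. \<exists>i. dist p (w i) \<le> inverse (Suc k))" for k
    proof -
      obtain n N :: nat where "\<forall>i. w i \<in> D n"
        "\<forall>p\<in>D n. \<exists>i\<in>{..N}. dist p (w i) \<le> inverse (Suc k)"
        using code'[of k] by blast
      then show ?thesis by (intro exI[of _ n]) blast
    qed
    ultimately have "closure (range w) \<in> components K"
      using component_range_closure[of K D w] Dn by blast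
    moreover have "closure (range w) \<subseteq> U"
      using w U by (intro closure_minimal) (auto simp: clopen_in_def)
    ultimately show "\<exists>C\<in>components K. C \<subseteq> U \<and> ?S homeomorphic C" using hom by blast
  }
qed

lemma homeomorphic_component_nonmeager:
  fixes E :: "'a::second_countable_topology \<Rightarrow> nat \<Rightarrow> 'p::complete_space"
    and K :: "'b::{complete_space,second_countable_topology} set"
  assumes E: "\<And>i. continuous_on UNIV (\<lambda>x. E x i)"
    and S: "\<And>x. compact (closure (range (E x)))" "\<And>x. connected (closure (range (E x)))"
    and K: "compact K" and U: "clopen_in K U"
    and nm: "\<not> meager {x. \<exists>C\<in>components K. C \<subseteq> U \<and> closure (range (E x)) homeomorphic C}"
  obtains G where "open G" "G \<noteq> {}"
    "meager (G - {x. \<exists>C\<in>components K. C \<subseteq> U \<and> closure (range (E x)) homeomorphic C})"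
proof -
  have "{D. clopen_in K D} \<noteq> {}" using U by blast
  then obtain D :: "nat \<Rightarrow> 'b set" where D: "range D = {D. clopen_in K D}"
    using countable_clopen_in[OF K] by (metis range_from_nat_into)
  have "closed (D n)" for n using D by (metis clopen_in_def mem_Collect_eq rangeI)
  then have F: "closed (homeomorphism_code E D k m)" for k m
    by (rule closed_homeomorphism_code[OF E])
  have "compact U" using U K unfolding clopen_in_def by (metis compact_Int_closed inf.absorb_iff2)
  then have "compact {w :: nat \<Rightarrow> 'b. \<forall>i. w i \<in> U}" by (rule compact_functions_into)
  from projection_nonmeager_comeager_open[OF this F homeomorphic_component_projection[OF S K U D] nm]
  show ?thesis using that .
qed

section \<open>Families over the Cantor space\<close>

text \<open>Makes \<open>nat \<Rightarrow> bool\<close> second countable, as the results on category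
  hulls require.\<close>

instance bool :: second_countable_topology
proof
  show "\<exists>B :: bool set set. countable B \<and> open = generate_topology B"
    by (intro exI[of _ "range lessThan \<union> range greaterThan"]) (auto simp: open_bool_def)
qed

lemma meager_involution:
  assumes f: "continuous_on UNIV f" "\<And>x. f (f x) = x" and A: "meager A"
  shows "meager (f -` A)"
proof -
  obtain F :: "nat \<Rightarrow> 'a set" where F: "\<And>n. closed (F n) \<and> interior (F n) = {}" "A \<subseteq> (\<Union>n. F n)"
    using A unfolding meager_def by blast
  have "interior (f -` F n) = {}" for n
  proof -
    have "open (f -` interior (f -` F n))" by (intro open_vimage open_interior f)
    moreover have "f -` interior (f -` F n) \<subseteq> F n"
    proof
      fix x assume "x \<in> f -` interior (f -` F n)"
      then have "f x \<in> f -` F n" using interior_subset by blast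
      then show "x \<in> F n" using f(2) by simp
    qed
    ultimately have "f -` interior (f -` F n) \<subseteq> interior (F n)" by (rule interior_maximal[rotated])
    then have "f -` interior (f -` F n) = {}" using F(1) by blast
    moreover have "f x \<in> f -` interior (f -` F n)" if "x \<in> interior (f -` F n)" for x
      using that f(2) by simp
    ultimately show ?thesis by blast
  qed
  moreover have "closed (f -` F n)" for n using F(1) f(1) by (intro closed_vimage) auto
  moreover have "f -` A \<subseteq> (\<Union>n. f -` F n)" using F(2) by blast
  ultimately show ?thesis unfolding meager_def by (intro exI[of _ "\<lambda>n. f -` F n"]) simp
qed

section \<open>Cylinders and category in the Cantor space\<close>

lemma continuous_on_coordinate_discrete:
  fixes g :: "'b::discrete_topology \<Rightarrow> 'c::topological_space"
  shows "continuous_on UNIV (\<lambda>x :: 'a \<Rightarrow> 'b. g (x i))"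
  by (rule continuous_on_compose2[OF Topological_Spaces.continuous_on_discrete continuous_on_product_coordinates]) auto

lemma open_cylinder:
  fixes a :: "nat \<Rightarrow> 'b::discrete_topology"
  shows "open {x. \<forall>i<n. x i = a i}"
proof -
  have "open {x. \<forall>i\<in>{..<n}. x i \<in> {a i}}"
    by (rule product_topology_basis') (auto intro: open_discrete)
  moreover have "{x. \<forall>i\<in>{..<n}. x i \<in> {a i}} = {x. \<forall>i<n. x i = a i}" by auto
  ultimately show ?thesis by simp
qed

lemma open_contains_cylinder:
  fixes a :: "nat \<Rightarrow> 'b::discrete_topology"
  assumes "open G" "a \<in> G"
  obtains n where "{x. \<forall>i<n. x i = a i} \<subseteq> G"
proof -
  have "openin (product_topology (\<lambda>_ :: nat. euclidean :: 'b topology) UNIV) G"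
    using assms by (simp add: euclidean_product_topology)
  then obtain X where X: "a \<in> PiE UNIV X" "finite {i. X i \<noteq> UNIV}" "PiE UNIV X \<subseteq> G"
    using product_topology_open_contains_basis[of "\<lambda>_. euclidean" UNIV G a] assms(2) by auto
  obtain n where n: "{i. X i \<noteq> UNIV} \<subseteq> {..<n}"
    using X(2) finite_nat_iff_bounded by blast
  have "x \<in> PiE UNIV X" if "\<forall>i<n. x i = a i" for x
  proof -
    have "x i \<in> X i" for i
      using that n X(1) by (cases "i < n") (auto simp: PiE_UNIV_domain)
    then show ?thesis by (auto simp: PiE_UNIV_domain)
  qed
  then show ?thesis using that X(3) by blast
qed

lemma compact_UNIV_bool_functions: "compact (UNIV :: ('a \<Rightarrow> bool) set)"
  using compact_functions_into[of "UNIV :: bool set"] by (simp add: finite_imp_compact)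

lemma Hausdorff_bool_functions: "Hausdorff_space (euclidean :: ('a \<Rightarrow> bool) topology)"
proof -
  have "Hausdorff_space (product_topology (\<lambda>_ :: 'a. euclidean :: bool topology) UNIV)"
    unfolding Hausdorff_space_product_topology
    by (auto simp: Hausdorff_space_def disjnt_def intro: hausdorff) (metis hausdorff)
  then show ?thesis by (simp add: euclidean_product_topology)
qed

lemma bool_functions_open_not_meager:
  fixes G :: "('a \<Rightarrow> bool) set"
  assumes "open G" "G \<noteq> {}"
  shows "\<not> meager G"
  using assms by (intro Baire_open_not_meager compact_UNIV_bool_functions Hausdorff_bool_functions)

text \<open>Serves two purposes: with \<open>r k = k\<close> a generic sequence takes the value
  \<open>b\<close> infinitely often; with \<open>r\<close> growing fast it has very long runs of
  \<open>b\<close>.\<close>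

lemma meager_eventually_no_run:
  fixes r :: "nat \<Rightarrow> nat" and b :: bool
  shows "meager {y. \<exists>m. \<forall>k\<ge>m. \<exists>i\<in>{k..r k}. y i \<noteq> b}"
proof -
  have "meager (\<Union>m. {y. \<forall>k\<ge>m. \<exists>i\<in>{k..r k}. y i \<noteq> b})"
  proof (rule meager_UN_nat, rule meager_nowhere_dense)
    fix m
    have "{y. \<forall>k\<ge>m. \<exists>i\<in>{k..r k}. y i \<noteq> b} = (\<Inter>k\<in>{m..}. \<Union>i\<in>{k..r k}. (\<lambda>y. y i) -` (- {b}))"
      by auto
    moreover have "closed (\<Inter>k\<in>{m..}. \<Union>i\<in>{k..r k}. (\<lambda>y :: nat \<Rightarrow> bool. y i) -` (- {b}))"
      by (intro closed_INT ballI closed_UN closed_vimage continuous_on_product_coordinates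
          finite_atLeastAtMost closed_Compl open_discrete)
    ultimately show "closed {y. \<forall>k\<ge>m. \<exists>i\<in>{k..r k}. y i \<noteq> b}" by simp
    show "interior {y. \<forall>k\<ge>m. \<exists>i\<in>{k..r k}. y i \<noteq> b} = {}" (is "?I = {}")
    proof (rule ccontr)
      assume "?I \<noteq> {}"
      then obtain a where "a \<in> ?I" by blast
      then obtain n where n: "{x. \<forall>i<n. x i = a i} \<subseteq> ?I"
        using open_contains_cylinder[OF open_interior] by blast
      \<comment> \<open>The change to \<open>b\<close> comes late enough to stay in the cylinder,
        and at an index at least \<open>m\<close>, so the window that starts there violates the
        condition.\<close>
      define y where "y i = (if i < max n m then a i else b)" for i
      have "y \<in> {x. \<forall>i<n. x i = a i}" by (simp add: y_def less_max_iff_disj)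
      then have "y \<in> ?I" by (rule subsetD[OF n])
      then have "y \<in> {y. \<forall>k\<ge>m. \<exists>i\<in>{k..r k}. y i \<noteq> b}" by (rule subsetD[OF interior_subset])
      then have "\<exists>i\<in>{max n m..r (max n m)}. y i \<noteq> b" by (elim CollectE allE impE) auto
      then obtain i where "i \<in> {max n m..r (max n m)}" "y i \<noteq> b" by (rule bexE)
      then show False by (auto simp: y_def split: if_splits)
    qed
  qed
  then show ?thesis by (rule meager_subset) auto
qed

definition flip :: "(nat \<Rightarrow> bool) \<Rightarrow> (nat \<Rightarrow> bool) \<Rightarrow> nat \<Rightarrow> bool" where
  "flip b x = (\<lambda>i. x i \<noteq> b i)"

lemma flip_flip: "flip b (flip b x) = x"
  by (auto simp: flip_def)

lemma continuous_on_flip: "continuous_on UNIV (flip b)"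
  unfolding flip_def
  by (intro continuous_on_coordinatewise_then_product continuous_on_coordinate_discrete)

text \<open>A zero-one law: invariance under finite flips and uniqueness prevent \<open>A U\<close>
  and \<open>A (K - U)\<close> from both being nonmeager. The comeager set \<open>J\<close> holds
  the parameters at which uniqueness is available.\<close>

lemma comeager_class_of_components:
  fixes E :: "(nat \<Rightarrow> bool) \<Rightarrow> nat \<Rightarrow> 'p::complete_space"
    and K :: "'b::{complete_space,second_countable_topology} set"
  assumes E: "\<And>i. continuous_on UNIV (\<lambda>x. E x i)"
    and S: "\<And>x. compact (closure (range (E x)))" "\<And>x. connected (closure (range (E x)))"
    and K: "compact K"
    and flip: "\<And>x b. finite {i. b i} \<Longrightarrow>
      closure (range (E x)) homeomorphic closure (range (E (flip b x)))"
    and J: "meager (- J)"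
    and unique: "\<And>x. x \<in> J \<Longrightarrow> \<exists>!C. C \<in> components K \<and> closure (range (E x)) homeomorphic C"
  obtains G where "meager (- G)"
    "\<And>x y. x \<in> G \<Longrightarrow> y \<in> G \<Longrightarrow> closure (range (E x)) homeomorphic closure (range (E y))"
proof -
  define A where "A U = {x. \<exists>C\<in>components K. C \<subseteq> U \<and> closure (range (E x)) homeomorphic C}" for U
  have dich: "meager (A U) \<or> meager (A (K - U))" if U: "clopen_in K U" for U
  proof (rule ccontr)
    assume "\<not> (meager (A U) \<or> meager (A (K - U)))"
    then have nm: "\<not> meager (A U)" "\<not> meager (A (K - U))" by auto
    obtain G1 where G1: "open G1" "G1 \<noteq> {}" "meager (G1 - A U)"
      by (rule homeomorphic_component_nonmeager[where E = E, OF E S K U nm(1)[unfolded A_def],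
            folded A_def])
    obtain G2 where G2: "open G2" "G2 \<noteq> {}" "meager (G2 - A (K - U))"
      by (rule homeomorphic_component_nonmeager[where E = E,
            OF E S K clopen_in_Diff[OF U] nm(2)[unfolded A_def], folded A_def])
    obtain a where a: "a \<in> G1" using G1 by blast
    obtain a' where a': "a' \<in> G2" using G2 by blast
    obtain n1 where n1: "{x. \<forall>i<n1. x i = a i} \<subseteq> G1" using open_contains_cylinder[OF G1(1) a] .
    obtain n2 where n2: "{x. \<forall>i<n2. x i = a' i} \<subseteq> G2" using open_contains_cylinder[OF G2(1) a'] .
    define n where "n = max n1 n2"
    \<comment> \<open>Flipping exactly these bits carries the cylinder \<open>N\<close> of
      \<open>a\<close>, which lies in \<open>G1\<close>, into the cylinder of \<open>a'\<close>,
      which lies in \<open>G2\<close>.\<close>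
    define b where "b i \<longleftrightarrow> i < n \<and> a i \<noteq> a' i" for i
    define N where "N = {x. \<forall>i<n. x i = a i}"
    have fin: "finite {i. b i}" by (rule finite_subset[of _ "{..<n}"]) (auto simp: b_def)
    have "N \<subseteq> (G1 - A U) \<union> flip b -` (G2 - A (K - U)) \<union> - J"
    proof
      fix x assume x: "x \<in> N"
      have "x \<in> G1" using x n1 by (auto simp: N_def n_def)
      moreover have "flip b x \<in> G2"
        using x n2 by (intro subsetD[OF n2]) (auto simp: N_def n_def flip_def b_def)
      moreover have False if "x \<in> J" "x \<in> A U" "flip b x \<in> A (K - U)"
      proof -
        obtain C where C: "C \<in> components K" "C \<subseteq> U" "closure (range (E x)) homeomorphic C"
          using \<open>x \<in> A U\<close> unfolding A_def by blast
        obtain C' where C': "C' \<in> components K" "C' \<subseteq> K - U"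
          "closure (range (E (flip b x))) homeomorphic C'"
          using \<open>flip b x \<in> A (K - U)\<close> unfolding A_def by blast
        have "closure (range (E x)) homeomorphic C'"
          using flip[OF fin] C'(3) by (rule homeomorphic_trans)
        \<comment> \<open>Both components are copies of the set belonging to \<open>x\<close>, one
          through the flip, although one lies in \<open>U\<close> and the other in
          \<open>K - U\<close>.\<close>
        then have "C = C'" using unique[OF \<open>x \<in> J\<close>] C C' by blast
        then have "C = {}" using C(2) C'(2) by blast
        then show False using C(1) in_components_nonempty by blast
      qed
      ultimately show "x \<in> (G1 - A U) \<union> flip b -` (G2 - A (K - U)) \<union> - J" by blast
    qed
    moreover have "meager ((G1 - A U) \<union> flip b -` (G2 - A (K - U)) \<union> - J)"
      by (intro meager_Un meager_involution continuous_on_flip flip_flip G1 G2 J)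
    ultimately have "meager N" by (rule meager_subset[rotated])
    moreover have "open N" unfolding N_def by (rule open_cylinder)
    moreover have "N \<noteq> {}" unfolding N_def by blast
    ultimately show False using bool_functions_open_not_meager by blast
  qed
  define \<M> where "\<M> = {U. clopen_in K U \<and> meager (A U)}"
  \<comment> \<open>For every clopen \<open>U\<close>, one of \<open>A U\<close> and
    \<open>A (K - U)\<close> is removed. Two points of \<open>G\<close> whose components could be
    separated by \<open>U\<close> would thus lose one of them.\<close>
  define G where "G = J - (\<Union>U\<in>\<M>. A U)"
  show ?thesis
  proof
    have "countable \<M>"
      unfolding \<M>_def by (rule countable_subset[OF _ countable_clopen_in[OF K]]) auto
    then have "meager (\<Union>U\<in>\<M>. A U)" by (rule meager_UN) (auto simp: \<M>_def)
    then have "meager (- J \<union> (\<Union>U\<in>\<M>. A U))" by (intro meager_Un J)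
    then show "meager (- G)" by (rule meager_subset) (auto simp: G_def)
    fix x y assume xy: "x \<in> G" "y \<in> G"
    obtain C where C: "C \<in> components K" "closure (range (E x)) homeomorphic C"
      using unique[of x] xy unfolding G_def by blast
    obtain C' where C': "C' \<in> components K" "closure (range (E y)) homeomorphic C'"
      using unique[of y] xy unfolding G_def by blast
    have "C = C'"
    proof (rule ccontr)
      assume "C \<noteq> C'"
      then obtain U where U: "clopen_in K U" "C \<subseteq> U" "C' \<subseteq> K - U"
        using components_separated_by_clopen_in[OF K C(1) C'(1)] by blast
      have "x \<in> A U" "y \<in> A (K - U)" using U C C' unfolding A_def by blast+
      moreover have "U \<in> \<M> \<or> K - U \<in> \<M>"
        using dich[OF U(1)] U(1) clopen_in_Diff unfolding \<M>_def by blast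
      ultimately show False using xy unfolding G_def by blast
    qed
    then show "closure (range (E x)) homeomorphic closure (range (E y))"
      using C(2) C'(2) homeomorphic_sym homeomorphic_trans by blast
  qed
qed

section \<open>Spirals with peaks of two heights\<close>

text \<open>One tent per unit interval. For negative \<open>t\<close> the function
  \<open>nat\<close> truncates to bit \<open>0\<close>, so the tents go on and continuity holds on
  the whole line.\<close>

definition zigzag :: "(nat \<Rightarrow> bool) \<Rightarrow> real \<Rightarrow> real" where
  "zigzag x t = (if x (nat \<lfloor>t\<rfloor>) then 1 else 1/2) * (1 - \<bar>2 * frac t - 1\<bar>)"

lemma zigzag_bounds: "0 \<le> zigzag x t" "zigzag x t \<le> 1"
proof -
  have "0 \<le> 1 - \<bar>2 * frac t - 1\<bar>" "1 - \<bar>2 * frac t - 1\<bar> \<le> 1"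
    using frac_ge_0[of t] frac_lt_1[of t] by linarith+
  then show "0 \<le> zigzag x t" "zigzag x t \<le> 1" by (auto simp: zigzag_def)
qed

lemma zigzag_block:
  assumes "real n \<le> t" "t \<le> real n + 1"
  shows "zigzag x t = (if x n then 1 else 1/2) * (1 - \<bar>2 * (t - real n) - 1\<bar>)"
proof (cases "t = real n + 1")
  case True
  \<comment> \<open>The right end already counts for the next block, but both tents vanish
    there.\<close>
  have "frac t = 0" unfolding True using frac_of_int[of "int n + 1"] by simp
  then have "zigzag x t = 0" unfolding zigzag_def by (simp only:) simp
  then show ?thesis using True by simp
next
  case False
  then have "\<lfloor>t\<rfloor> = int n" using assms by (intro floor_unique) auto
  then show ?thesis by (simp add: zigzag_def frac_def)
qed

lemma zigzag_nat: "zigzag x (real n) = 0"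
  using zigzag_block[of n "real n" x] by simp

lemma zigzag_peak: "zigzag x (real n + 1/2) = (if x n then 1 else 1/2)"
  using zigzag_block[of n "real n + 1/2" x] by simp

lemma zigzag_low:
  assumes "real n \<le> t" "t \<le> real n + 1" "\<not> x n"
  shows "zigzag x t \<le> 1/2"
  using zigzag_block[OF assms(1,2), of x] assms(3) by simp

text \<open>Serves as a test: if a value drops below those at two points on either side of it, the
  two points do not share a block.\<close>

lemma zigzag_quasiconcave:
  assumes "real n \<le> a" "a \<le> b" "b \<le> c" "c \<le> real n + 1"
  shows "min (zigzag x a) (zigzag x c) \<le> zigzag x b"
proof -
  have "min (1 - \<bar>2 * (a - real n) - 1\<bar>) (1 - \<bar>2 * (c - real n) - 1\<bar>) \<le> 1 - \<bar>2 * (b - real n) - 1\<bar>"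
    using assms by (auto simp: min_def abs_if)
  then show ?thesis
    using assms zigzag_block[of n a x] zigzag_block[of n b x] zigzag_block[of n c x]
    by (auto simp: min_def split: if_splits)
qed

lemma zigzag_Lipschitz_le:
  assumes "s \<le> t"
  shows "\<bar>zigzag x s - zigzag x t\<bar> \<le> 2 * (t - s)"
proof (cases "\<lfloor>s\<rfloor> = \<lfloor>t\<rfloor>")
  case True
  then have le: "\<bar>\<bar>2 * frac t - 1\<bar> - \<bar>2 * frac s - 1\<bar>\<bar> \<le> 2 * (t - s)"
    using assms by (simp add: frac_def)
  have "\<bar>c * (1 - b) - c * (1 - a)\<bar> \<le> r" if "\<bar>a - b\<bar> \<le> r" "c = 1 \<or> c = 1/2" for a b c r :: real
  proof -
    have "c * (1 - b) - c * (1 - a) = c * (a - b)" by (simp add: algebra_simps)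
    moreover have "\<bar>c * (a - b)\<bar> \<le> \<bar>a - b\<bar>" using that(2) by (auto simp: abs_mult simp del: eq_divide_eq_numeral1)
    ultimately show ?thesis using that(1) by simp
  qed
  from this[OF le] show ?thesis unfolding zigzag_def True by simp
next
  case False
  then have "\<lfloor>s\<rfloor> + 1 \<le> \<lfloor>t\<rfloor>" using floor_mono[OF assms] by linarith
  then have fl: "real_of_int \<lfloor>s\<rfloor> + 1 \<le> real_of_int \<lfloor>t\<rfloor>" by linarith
  have le: "zigzag x r \<le> 1 - \<bar>2 * frac r - 1\<bar>" for r
  proof -
    have "0 \<le> 1 - \<bar>2 * frac r - 1\<bar>" using frac_ge_0[of r] frac_lt_1[of r] by linarith
    then show ?thesis by (auto simp: zigzag_def)
  qed
  \<comment> \<open>The tents vanish at the end of the block of \<open>s\<close> and at the start of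
    the block of \<open>t\<close>; both integers lie between \<open>s\<close> and \<open>t\<close>,
    and the slopes are at most \<open>2\<close>.\<close>
  have "zigzag x s \<le> 2 * (real_of_int \<lfloor>s\<rfloor> + 1 - s)" using le[of s] by (simp add: frac_def)
  moreover have "zigzag x t \<le> 2 * (t - real_of_int \<lfloor>t\<rfloor>)" using le[of t] by (simp add: frac_def)
  ultimately show ?thesis
    using fl zigzag_bounds(1)[of x s] zigzag_bounds(1)[of x t] of_int_floor_le[of t] real_of_int_floor_add_one_gt[of s]
    by (simp add: abs_le_iff)
qed

lemma continuous_on_zigzag: "continuous_on A (zigzag x)"
proof -
  have "2-lipschitz_on UNIV (zigzag x)"
  proof (rule lipschitz_onI)
    fix s t :: real
    show "dist (zigzag x s) (zigzag x t) \<le> 2 * dist s t"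
      using zigzag_Lipschitz_le[of s t x] zigzag_Lipschitz_le[of t s x]
      by (cases "s \<le> t") (auto simp: dist_real_def abs_minus_commute)
  qed simp
  then have "continuous_on UNIV (zigzag x)" by (rule lipschitz_on_continuous_on)
  then show ?thesis by (rule continuous_on_subset) simp
qed

section \<open>The rays, their closures and their remainders\<close>

text \<open>A relative of the topologist's sine curve. The first coordinate determines the
  parameter, so the ray is a graph over the interval from \<open>0\<close> (excluded) to
  \<open>1\<close>, and it tends to \<open>0\<close>, so the ray accumulates on a vertical
  segment.\<close>

definition ray :: "(nat \<Rightarrow> bool) \<Rightarrow> real \<Rightarrow> real \<times> real" where
  "ray x t = (inverse (1 + t), zigzag x t)"

definition spiral :: "(nat \<Rightarrow> bool) \<Rightarrow> (real \<times> real) set" where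
  "spiral x = closure (ray x ` {0..})"

text \<open>A dense sequence in the spiral. Its parameters do not depend on \<open>x\<close>, so
  each term depends on one bit of \<open>x\<close> only and is continuous in
  \<open>x\<close>.\<close>

definition ray_point :: "(nat \<Rightarrow> bool) \<Rightarrow> nat \<Rightarrow> real \<times> real" where
  "ray_point x i = ray x \<bar>real_of_rat (from_nat i)\<bar>"

lemma continuous_on_ray: "A \<subseteq> {0..} \<Longrightarrow> continuous_on A (ray x)"
  unfolding ray_def by (intro continuous_intros continuous_on_zigzag) auto

lemma continuous_on_ray_point: "continuous_on UNIV (\<lambda>x. ray_point x i)"
  unfolding ray_point_def ray_def zigzag_def
  by (intro continuous_intros continuous_on_coordinate_discrete)

lemma closure_range_ray_point: "closure (range (ray_point x)) = spiral x"
proof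
  let ?q = "\<lambda>i. \<bar>real_of_rat (from_nat i)\<bar>"
  have "range (ray_point x) \<subseteq> ray x ` {0..}" by (auto simp: ray_point_def)
  then show "closure (range (ray_point x)) \<subseteq> spiral x"
    unfolding spiral_def by (rule closure_mono)
  have "{0..} \<subseteq> closure (range ?q)"
  proof
    fix t :: real assume "t \<in> {0..}"
    show "t \<in> closure (range ?q)"
      unfolding closure_approachable
    proof (intro allI impI)
      fix \<epsilon> :: real assume "\<epsilon> > 0"
      then obtain r where r: "t < real_of_rat r" "real_of_rat r < t + \<epsilon>"
        using of_rat_dense[of t "t + \<epsilon>"] by auto
      have "0 \<le> t" using \<open>t \<in> {0..}\<close> by simp
      then have "real_of_rat r > 0" using r(1) by linarith
      then have "?q (to_nat r) = real_of_rat r" using r \<open>t \<in> {0..}\<close> by simp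
      then have "real_of_rat r \<in> range ?q" by (metis rangeI)
      then show "\<exists>y\<in>range ?q. dist y t < \<epsilon>"
        by (rule bexI[rotated]) (use r in \<open>auto simp: dist_real_def\<close>)
    qed
  qed
  moreover have cl: "closure (range ?q) \<subseteq> {0..}"
    by (rule closure_minimal) auto
  moreover have "ray x ` closure (range ?q) \<subseteq> closure (range (ray_point x))"
    by (rule image_closure_subset)
      (use cl closure_subset[of "range (ray_point x)"] in \<open>auto simp: ray_point_def intro!: continuous_on_ray\<close>)
  ultimately have "ray x ` {0..} \<subseteq> closure (range (ray_point x))" by blast
  then show "spiral x \<subseteq> closure (range (ray_point x))"
    unfolding spiral_def by (simp add: closure_minimal)
qed

lemma ray_in_box: "t \<ge> 0 \<Longrightarrow> ray x t \<in> {0..1} \<times> {0..1}"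
  using zigzag_bounds[of x t] by (auto simp: ray_def inverse_le_1_iff)

lemma compact_spiral: "compact (spiral x)"
proof -
  have "ray x ` {0..} \<subseteq> {0..1} \<times> {0..1}"
    by (rule image_subsetI, rule ray_in_box) simp
  then have "bounded (ray x ` {0..})"
    by (rule bounded_subset[rotated]) (intro bounded_Times bounded_closed_interval)
  then show ?thesis by (simp add: spiral_def)
qed

lemma connected_spiral: "connected (spiral x)"
  unfolding spiral_def
  by (intro connected_imp_connected_closure connected_continuous_image continuous_on_ray) auto

text \<open>Both rays are graphs over the same interval, and the two functions agree near
  \<open>0\<close>. The vertical shear by their difference \<open>g\<close> is therefore a
  homeomorphism of the plane that carries one spiral to the other.\<close>

lemma spiral_homeomorphic_flip:
  assumes "finite {i. b i}"
  shows "spiral x homeomorphic spiral (flip b x)"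
proof -
  obtain N where N: "{i. b i} \<subseteq> {..<N}" using assms finite_nat_iff_bounded by blast
  let ?y = "flip b x"
  define g where "g u = (if u \<le> 0 then 0 else zigzag ?y (inverse u - 1) - zigzag x (inverse u - 1))" for u
  have eq: "zigzag ?y t = zigzag x t" if "t \<ge> real N" for t
  proof -
    have "N \<le> nat \<lfloor>t\<rfloor>" using that by (simp add: le_nat_floor)
    then have "\<not> b (nat \<lfloor>t\<rfloor>)" using N by (auto dest!: subsetD[of _ _ "nat \<lfloor>t\<rfloor>"])
    then show ?thesis by (simp add: zigzag_def flip_def)
  qed
  have g0: "g u = 0" if "u < inverse (real N + 1)" for u
  proof (cases "u \<le> 0")
    case False
    then have "real N + 1 < inverse u" using that by (metis inverse_inverse_eq less_imp_inverse_less not_le)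
    then show ?thesis using eq[of "inverse u - 1"] by (simp add: g_def)
  qed (simp add: g_def)
  \<comment> \<open>Two overlapping open sets suffice: \<open>g\<close> vanishes left of
    \<open>inverse (real N + 1)\<close>, and right of \<open>0\<close> it is a difference of
    compositions.\<close>
  have contg: "continuous_on UNIV g"
  proof -
    have "continuous_on {..<inverse (real N + 1)} g"
      by (rule continuous_on_cong[THEN iffD2, OF refl _ continuous_on_const[of _ 0]]) (use g0 in auto)
    moreover have "continuous_on {0<..} g"
    proof -
      have "continuous_on {0<..} (\<lambda>u. zigzag ?y (inverse u - 1) - zigzag x (inverse u - 1))"
        by (intro continuous_intros continuous_on_compose2[OF continuous_on_zigzag[of UNIV]]) auto
      then show ?thesis
        by (rule continuous_on_cong[THEN iffD1, OF refl, rotated]) (auto simp: g_def)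
    qed
    ultimately have "continuous_on ({..<inverse (real N + 1)} \<union> {0<..}) g"
      by (intro continuous_on_open_Un) auto
    moreover have "{..<inverse (real N + 1)} \<union> {0<..} = (UNIV :: real set)"
      by auto (metis add_nonneg_pos inverse_positive_iff_positive not_le of_nat_0_le_iff order.strict_trans1 zero_less_one)
    ultimately show ?thesis by simp
  qed
  have contfst: "continuous_on A (\<lambda>p :: real \<times> real. g (fst p))" for A
    by (rule continuous_on_compose2[OF contg]) (auto intro: continuous_intros)
  define f where "f p = (fst p, snd p + g (fst p))" for p :: "real \<times> real"
  define f' where "f' p = (fst p, snd p - g (fst p))" for p :: "real \<times> real"
  have cont: "continuous_on A f" "continuous_on A f'" for A
    unfolding f_def f'_def by (intro continuous_intros contfst)+
  have ray: "f (ray x t) = ray ?y t" "f' (ray ?y t) = ray x t" if "t \<ge> 0" for t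
    using that by (auto simp: f_def f'_def ray_def g_def not_le)
  have "f ` spiral x \<subseteq> spiral ?y"
    unfolding spiral_def
    by (rule image_closure_subset[OF cont(1)])
      (use ray closure_subset[of "ray ?y ` {0..}"] in auto)
  moreover have "f' ` spiral ?y \<subseteq> spiral x"
    unfolding spiral_def
    by (rule image_closure_subset[OF cont(2)])
      (use ray closure_subset[of "ray x ` {0..}"] in auto)
  moreover have "f' (f p) = p" "f (f' p) = p" for p by (simp_all add: f_def f'_def)
  ultimately show ?thesis
    unfolding homeomorphic_minimal using cont by (intro exI[of _ f] exI[of _ f']) auto
qed

definition infinitely_often :: "bool \<Rightarrow> (nat \<Rightarrow> bool) set" where
  "infinitely_often b = {x. \<forall>m. \<exists>k\<ge>m. x k = b}"

lemma meager_not_infinitely_often: "meager (- infinitely_often b)"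
  by (rule meager_subset[OF meager_eventually_no_run[where r = "\<lambda>k. k" and b = b]])
    (auto simp: infinitely_often_def)

lemma mem_ray_iff: "p \<in> ray x ` {0..} \<longleftrightarrow> 0 < fst p \<and> fst p \<le> 1 \<and> snd p = zigzag x (inverse (fst p) - 1)"
proof
  assume "p \<in> ray x ` {0..}"
  then show "0 < fst p \<and> fst p \<le> 1 \<and> snd p = zigzag x (inverse (fst p) - 1)"
    by (auto simp: ray_def inverse_le_1_iff)
next
  assume p: "0 < fst p \<and> fst p \<le> 1 \<and> snd p = zigzag x (inverse (fst p) - 1)"
  then have "1 \<le> inverse (fst p)" by (simp add: one_le_inverse)
  moreover have "p = ray x (inverse (fst p) - 1)" using p by (simp add: ray_def prod_eq_iff)
  ultimately show "p \<in> ray x ` {0..}" by (intro image_eqI[of _ _ "inverse (fst p) - 1"]) auto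
qed

text \<open>Infinitely many high peaks make the ray sweep through all heights up to \<open>1\<close>
  arbitrarily far out, so the remainder is the full segment.\<close>

lemma spiral_eq:
  assumes x: "x \<in> infinitely_often True"
  shows "spiral x = {0} \<times> {0..1} \<union> ray x ` {0..}"
proof
  let ?T = "{0} \<times> {0..1} \<union> ray x ` {0..}"
  have T: "p \<in> ?T \<longleftrightarrow> p \<in> {0..1} \<times> {0..1} \<and> (fst p > 0 \<longrightarrow> snd p = zigzag x (inverse (fst p) - 1))" for p
    using zigzag_bounds[of x] unfolding Un_iff mem_ray_iff by (cases p) auto
  have "closed ?T"
    unfolding closed_sequential_limits
  proof (intro allI impI, elim conjE)
    fix p l assume p: "\<forall>n. p n \<in> ?T" and lim: "p \<longlonglongrightarrow> l"
    have "closed ({0..1} \<times> {0..1} :: (real \<times> real) set)" by (intro closed_Times closed_atLeastAtMost)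
    then have l: "l \<in> {0..1} \<times> {0..1}"
      using p lim unfolding T closed_sequential_limits by blast
    have f: "(\<lambda>n. fst (p n)) \<longlonglongrightarrow> fst l" and s: "(\<lambda>n. snd (p n)) \<longlonglongrightarrow> snd l"
      using lim by (auto intro: tendsto_fst tendsto_snd)
    have "snd l = zigzag x (inverse (fst l) - 1)" if "fst l > 0"
    proof -
      have "isCont (zigzag x) (inverse (fst l) - 1)"
        using continuous_on_zigzag[of UNIV x] by (simp add: continuous_on_eq_continuous_at)
      moreover have "(\<lambda>n. inverse (fst (p n)) - 1) \<longlonglongrightarrow> inverse (fst l) - 1"
        using that by (intro tendsto_intros f) auto
      ultimately have "(\<lambda>n. zigzag x (inverse (fst (p n)) - 1)) \<longlonglongrightarrow> zigzag x (inverse (fst l) - 1)"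
        by (rule isCont_tendsto_compose)
      moreover have "\<forall>\<^sub>F n in sequentially. fst (p n) > 0"
        using f that by (rule order_tendstoD)
      then have "\<forall>\<^sub>F n in sequentially. zigzag x (inverse (fst (p n)) - 1) = snd (p n)"
      proof (rule eventually_mono)
        fix n assume "0 < fst (p n)"
        moreover have "p n \<in> ?T" using p by (rule spec)
        ultimately show "zigzag x (inverse (fst (p n)) - 1) = snd (p n)" unfolding T by simp
      qed
      ultimately have "(\<lambda>n. snd (p n)) \<longlonglongrightarrow> zigzag x (inverse (fst l) - 1)"
        by (simp add: tendsto_cong)
      then show ?thesis using s LIMSEQ_unique by blast
    qed
    then show "l \<in> ?T" unfolding T using l by blast
  qed
  then show "spiral x \<subseteq> ?T"
    unfolding spiral_def by (intro closure_minimal) auto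
  have "(0, s) \<in> spiral x" if s: "0 \<le> s" "s \<le> 1" for s
    unfolding spiral_def closure_approachable
  proof (intro allI impI)
    fix \<epsilon> :: real assume "\<epsilon> > 0"
    then obtain m where m: "inverse (real (Suc m)) < \<epsilon>" using reals_Archimedean by blast
    obtain k where k: "k \<ge> m" "x k" using x by (auto simp: infinitely_often_def)
    \<comment> \<open>The point at height \<open>s\<close> on the rising flank, of slope
      \<open>2\<close>, of the high peak \<open>k\<close>.\<close>
    let ?t = "real k + s / 2"
    have "zigzag x ?t = s" using zigzag_block[of k ?t x] k s by simp
    then have "dist (ray x ?t) (0, s) = inverse (1 + ?t)"
      using s by (simp add: ray_def dist_Pair_Pair dist_real_def)
    also have "\<dots> \<le> inverse (real (Suc m))" using k s by (intro le_imp_inverse_le) auto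
    also have "\<dots> < \<epsilon>" by (rule m)
    finally show "\<exists>y\<in>ray x ` {0..}. dist y (0, s) < \<epsilon>"
      using s by (intro bexI[of _ "ray x ?t"]) auto
  qed
  then show "?T \<subseteq> spiral x"
    using closure_subset[of "ray x ` {0..}"] by (auto simp: spiral_def)
qed

lemma spiral_over_spiral:
  assumes x: "x \<in> infinitely_often True"
  shows "spiral_over (top_of_set {0..1::real}) (top_of_set (spiral x))"
proof -
  let ?R = "top_of_set {0::real..}" and ?S = "top_of_set (spiral x)"
  have sub: "ray x ` {0..} \<subseteq> spiral x" unfolding spiral_def by (rule closure_subset)
  have "homeomorphic_maps ?R (top_of_set (ray x ` {0..})) (ray x) (\<lambda>p. inverse (fst p) - 1)"
    unfolding homeomorphic_maps_def
  proof (intro conjI)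
    show "continuous_map ?R (top_of_set (ray x ` {0..})) (ray x)"
      by (simp add: continuous_map_in_subtopology continuous_on_ray)
    have "continuous_on (ray x ` {0..}) (\<lambda>p. inverse (fst p) - 1)"
      by (intro continuous_intros) (auto simp: mem_ray_iff)
    then show "continuous_map (top_of_set (ray x ` {0..})) ?R (\<lambda>p. inverse (fst p) - 1)"
      by (auto simp: continuous_map_in_subtopology ray_def)
  qed (auto simp: ray_def)
  then have "homeomorphic_map ?R (subtopology ?S (ray x ` topspace ?R)) (ray x)"
    using sub by (auto simp: homeomorphic_map_maps subtopology_subtopology inf.absorb2)
  then have "embedding_map ?R ?S (ray x)" by (simp add: embedding_map_def)
  moreover have "compact_space ?S" using compact_spiral by (simp add: compact_space_subtopology)
  moreover have "metrizable_space ?S" by (simp add: metrizable_space_euclidean metrizable_space_subtopology)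
  moreover have "?S closure_of (ray x ` topspace ?R) = topspace ?S"
    using sub by (simp add: closure_of_subtopology inf.absorb2 spiral_def)
  ultimately have "metrizable_compactification ?R ?S (ray x)"
    unfolding metrizable_compactification_def by blast
  moreover have "remainder_of ?R ?S (ray x) homeomorphic_space top_of_set {0..1::real}"
  proof -
    have "spiral x - ray x ` {0..} = {0} \<times> {0..1}"
      unfolding spiral_eq[OF x] by (auto simp: ray_def)
    then have "remainder_of ?R ?S (ray x) = top_of_set ({0} \<times> {0..1})"
      unfolding remainder_of_def using spiral_eq[OF x]
      by (simp add: subtopology_subtopology inf.absorb2)
    moreover have "homeomorphic_maps (top_of_set ({0} \<times> {0..1})) (top_of_set {0..1}) snd (\<lambda>s :: real. (0 :: real, s :: real))"
      unfolding homeomorphic_maps_def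
      by (auto simp: continuous_map_in_subtopology intro!: continuous_intros)
    ultimately show ?thesis unfolding homeomorphic_space_def by auto
  qed
  ultimately show ?thesis unfolding spiral_over_def by blast
qed

section \<open>Homeomorphisms between spirals\<close>

lemma ray_inj: "t \<ge> 0 \<Longrightarrow> s \<ge> 0 \<Longrightarrow> ray x t = ray x s \<Longrightarrow> t = s"
  by (simp add: ray_def)

text \<open>Recognizes the open ray topologically. Removing the end point of the ray or a point of
  the remainder leaves a set between a connected part of the ray and its closure.\<close>

lemma spiral_cut_point_iff:
  assumes x: "x \<in> infinitely_often True" and p: "p \<in> spiral x"
  shows "\<not> connected (spiral x - {p}) \<longleftrightarrow> (\<exists>t>0. p = ray x t)"
proof
  assume nc: "\<not> connected (spiral x - {p})"
  have conn: "connected (ray x ` A)" if "connected A" "A \<subseteq> {0..}" for A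
    using that by (intro connected_continuous_image continuous_on_ray)
  have "p \<in> ray x ` {0..}"
  proof (rule ccontr)
    assume "p \<notin> ray x ` {0..}"
    moreover have "ray x ` {0..} \<subseteq> spiral x" unfolding spiral_def by (rule closure_subset)
    ultimately have "ray x ` {0..} \<subseteq> spiral x - {p}" by blast
    moreover have "spiral x - {p} \<subseteq> closure (ray x ` {0..})" by (auto simp: spiral_def)
    ultimately have "connected (spiral x - {p})"
      using connected_intermediate_closure[OF conn[of "{0..}"]] by auto
    then show False using nc by blast
  qed
  moreover have "p \<noteq> ray x 0"
  proof
    assume p0: "p = ray x 0"
    have split: "{0::real..} = insert 0 {0<..}" by auto
    have "ray x 0 \<notin> ray x ` {0<..}" by (auto simp: ray_def)
    moreover have "ray x ` {0<..} \<subseteq> spiral x"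
      using closure_subset[of "ray x ` {0..}"] by (auto simp: spiral_def)
    ultimately have "ray x ` {0<..} \<subseteq> spiral x - {p}" unfolding p0 by blast
    moreover have "spiral x - {p} \<subseteq> closure (ray x ` {0<..})"
      unfolding p0 spiral_def split by (auto simp: closure_insert)
    moreover have "connected (ray x ` {0<..})" by (rule conn) auto
    ultimately have "connected (spiral x - {p})"
      by (blast intro: connected_intermediate_closure)
    then show False using nc by blast
  qed
  ultimately show "\<exists>t>0. p = ray x t" by (auto simp: less_eq_real_def)
next
  assume "\<exists>t>0. p = ray x t"
  then obtain t where t: "t > 0" "p = ray x t" by blast
  show "\<not> connected (spiral x - {p})"
  proof
    assume "connected (spiral x - {p})"
    \<comment> \<open>Only \<open>p\<close> has first coordinate \<open>inverse (1 + t)\<close>, so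
      the projection contains \<open>0\<close> and \<open>1\<close> but not this value in
      between.\<close>
    then have "connected (fst ` (spiral x - {p}))"
      by (intro connected_continuous_image continuous_intros)
    moreover have "0 \<in> fst ` (spiral x - {p})"
      using t by (intro image_eqI[of _ _ "(0, 0)"]) (auto simp: spiral_eq[OF x] ray_def)
    moreover have "1 \<in> fst ` (spiral x - {p})"
      using t by (intro image_eqI[of _ _ "ray x 0"]) (auto simp: spiral_eq[OF x] ray_def)
    moreover have "0 \<le> inverse (1 + t)" "inverse (1 + t) \<le> 1"
      using t by (simp_all add: inverse_le_1_iff)
    ultimately have "inverse (1 + t) \<in> fst ` (spiral x - {p})"
      using connectedD_interval by blast
    then obtain q where "q \<in> spiral x - {p}" "fst q = inverse (1 + t)" by (metis imageE)
    then show False using t by (auto simp: spiral_eq[OF x] ray_def)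
  qed
qed

text \<open>What remains of a homeomorphism between two spirals: \<open>\<phi>\<close> reparametrizes the open ray and \<open>h\<close> is
  the restriction to the remainder.\<close>

definition matching :: "(nat \<Rightarrow> bool) \<Rightarrow> (nat \<Rightarrow> bool) \<Rightarrow> (real \<Rightarrow> real) \<Rightarrow> (real \<Rightarrow> real) \<Rightarrow> bool" where
  "matching x y \<phi> h \<longleftrightarrow> (\<forall>t>0. 0 < \<phi> t) \<and> strict_mono_on {0<..} \<phi> \<and>
     (\<forall>\<epsilon>>0. \<exists>T>0. \<forall>t\<ge>T. \<bar>zigzag y (\<phi> t) - h (zigzag x t)\<bar> < \<epsilon>)"

lemma matching_close:
  "matching x y \<phi> h \<Longrightarrow> 0 < \<epsilon> \<Longrightarrow> \<exists>T>0. \<forall>t\<ge>T. \<bar>zigzag y (\<phi> t) - h (zigzag x t)\<bar> < \<epsilon>"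
  by (simp add: matching_def)

lemma matching_pos: "matching x y \<phi> h \<Longrightarrow> 0 < t \<Longrightarrow> 0 < \<phi> t"
  by (simp add: matching_def)

lemma matching_less: "matching x y \<phi> h \<Longrightarrow> 0 < s \<Longrightarrow> s < t \<Longrightarrow> \<phi> s < \<phi> t"
  by (auto simp: matching_def strict_mono_on_def)

lemma homeomorphism_Diff_point:
  assumes "homeomorphism S T f g" "p \<in> S"
  shows "f ` (S - {p}) = T - {f p}"
proof -
  have f: "f ` S = T" and inj: "inj_on f S"
    using assms(1) unfolding homeomorphism_def by (blast, metis inj_on_inverseI)
  have "f ` (S - {p}) = f ` S - f ` {p}"
    by (rule inj_on_image_set_diff[OF inj]) (use assms(2) in auto)
  then show ?thesis using f by simp
qed

lemma spiral_homeomorphism_matching: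
  assumes x: "x \<in> infinitely_often True" and y: "y \<in> infinitely_often True"
    and hom: "homeomorphism (spiral x) (spiral y) f g"
  obtains \<phi> h where "matching x y \<phi> h" "\<And>t. t > 0 \<Longrightarrow> f (ray x t) = ray y (\<phi> t)"
    "\<And>s. s \<in> {0..1} \<Longrightarrow> h s \<in> {0..1} \<and> f (0, s) = (0, h s)"
    "continuous_on {0..1} h"
proof -
  define \<phi> where "\<phi> t = inverse (fst (f (ray x t))) - 1" for t
  define h where "h s = snd (f (0, s))" for s
  have f: "continuous_on (spiral x) f" "f ` spiral x = spiral y"
    and g: "continuous_on (spiral y) g" "g ` spiral y = spiral x"
    and gf: "\<And>p. p \<in> spiral x \<Longrightarrow> g (f p) = p" and fg: "\<And>p. p \<in> spiral y \<Longrightarrow> f (g p) = p"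
    using hom unfolding homeomorphism_def by auto
  have fS: "f p \<in> spiral y" if "p \<in> spiral x" for p using f(2) that by blast
  have injf: "p = q" if "f p = f q" "p \<in> spiral x" "q \<in> spiral x" for p q
    using gf that by metis
  have rayS: "ray x t \<in> spiral x" if "t \<ge> 0" for t using that by (auto simp: spiral_eq[OF x])
  have cut: "(\<exists>t>0. p = ray x t) \<longleftrightarrow> (\<exists>t>0. f p = ray y t)" if p: "p \<in> spiral x" for p
  proof -
    have "f ` (spiral x - {p}) = spiral y - {f p}"
      by (rule homeomorphism_Diff_point[OF hom p])
    moreover have "g ` (spiral y - {f p}) = spiral x - {g (f p)}"
      by (rule homeomorphism_Diff_point[OF homeomorphism_symD[OF hom] fS[OF p]])
    ultimately have "connected (spiral x - {p}) \<longleftrightarrow> connected (spiral y - {f p})"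
      using f(1) g(1) gf[OF p] by (metis Diff_subset connected_continuous_image continuous_on_subset)
    then show ?thesis using spiral_cut_point_iff[OF x p] spiral_cut_point_iff[OF y fS[OF p]] by blast
  qed
  have phi: "\<phi> t > 0 \<and> f (ray x t) = ray y (\<phi> t)" if "t > 0" for t
  proof -
    have "\<exists>s>0. f (ray x t) = ray y s" using cut[OF rayS[of t]] that by (metis less_imp_le)
    then obtain s where "s > 0" "f (ray x t) = ray y s" by blast
    moreover from this have "\<phi> t = s" by (simp add: \<phi>_def ray_def)
    ultimately show ?thesis by simp
  qed
  let ?I = "{0} \<times> {0..1::real} :: (real \<times> real) set"
  have I: "?I \<subseteq> spiral x" by (auto simp: spiral_eq[OF x])
  have fst01: "fst (f p) = 0 \<or> f p = ray y 0" if "p \<in> ?I" for p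
  proof -
    have "\<not> (\<exists>t>0. p = ray x t)" using that by (auto simp: ray_def)
    then have "\<not> (\<exists>t>0. f p = ray y t)" using cut that I by blast
    moreover have "f p \<in> spiral y" using fS that I by blast
    ultimately show ?thesis by (auto simp: spiral_eq[OF y] less_eq_real_def)
  qed
  \<comment> \<open>Cut points leave two possibilities for the image of a remainder point, with
    first coordinates \<open>0\<close> and \<open>1\<close>. By connectedness only one occurs on the
    segment, and the second would collapse the segment to \<open>ray y 0\<close>.\<close>
  have fst0: "fst (f p) = 0" if p: "p \<in> ?I" for p
  proof (rule ccontr)
    assume np: "fst (f p) \<noteq> 0"
    then have p1: "f p = ray y 0" using fst01 p by blast
    have "connected ((\<lambda>p. fst (f p)) ` ?I)"
      by (intro connected_continuous_image continuous_intros continuous_on_subset[OF f(1) I]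
          connected_Times) auto
    moreover have "1 \<in> (\<lambda>p. fst (f p)) ` ?I" using p p1 by (intro image_eqI[of _ _ p]) (auto simp: ray_def)
    moreover have no: "(1/2 :: real) \<notin> (\<lambda>p. fst (f p)) ` ?I" using fst01 by (force simp: ray_def)
    ultimately have "fst (f q) \<noteq> 0" if "q \<in> ?I" for q
      using connectedD_interval[of "(\<lambda>p. fst (f p)) ` ?I" 0 1 "1/2"] that by force
    then have "f (0, 0) = ray y 0" "f (0, 1) = ray y 0" using fst01 by auto
    then have "f (0, 0) = f (0, 1)" by simp
    moreover have "(0, 0) \<in> spiral x" "(0, 1) \<in> spiral x" by (auto simp: spiral_eq[OF x])
    ultimately show False using injf[of "(0, 0)" "(0, 1)"] by simp
  qed
  have hs: "h s \<in> {0..1} \<and> f (0, s) = (0, h s)" if "s \<in> {0..1}" for s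
  proof -
    have "(0, s) \<in> ?I" using that by simp
    then have "fst (f (0, s)) = 0" "f (0, s) \<in> spiral y" using fst0 fS I by blast+
    then show ?thesis by (auto simp: spiral_eq[OF y] h_def ray_def prod_eq_iff)
  qed
  have conth: "continuous_on {0..1} h"
    unfolding h_def
    by (intro continuous_intros continuous_on_compose2[OF f(1)]) (use I in auto)
  \<comment> \<open>Compare \<open>ray x t\<close> with the remainder point of the same height, at
    distance \<open>inverse (1 + t)\<close>, and use uniform continuity of \<open>f\<close>.\<close>
  have near: "\<exists>T>0. \<forall>t\<ge>T. dist (f (ray x t)) (0, h (zigzag x t)) < \<epsilon>" if "\<epsilon> > 0" for \<epsilon>
  proof -
    obtain \<delta> where \<delta>: "\<delta> > 0" "\<And>p q. p \<in> spiral x \<Longrightarrow> q \<in> spiral x \<Longrightarrow> dist q p < \<delta> \<Longrightarrow> dist (f q) (f p) < \<epsilon>"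
    proof -
      have "\<exists>\<delta>>0. \<forall>p\<in>spiral x. \<forall>q\<in>spiral x. dist q p < \<delta> \<longrightarrow> dist (f q) (f p) < \<epsilon>"
        using compact_uniformly_continuous[OF f(1) compact_spiral] \<open>\<epsilon> > 0\<close>
        unfolding uniformly_continuous_on_def by blast
      then show ?thesis using that by blast
    qed
    show ?thesis
    proof (intro exI[of _ "inverse \<delta>"] conjI allI impI)
      show "0 < inverse \<delta>" using \<delta> by simp
      fix t assume t: "inverse \<delta> \<le> t"
      then have "t > 0" using \<delta>(1) by (metis inverse_positive_iff_positive less_le_trans)
      have "dist (ray x t) (0, zigzag x t) = inverse (1 + t)"
        using \<open>t > 0\<close> by (simp add: ray_def dist_Pair_Pair dist_real_def)
      also have "\<dots> < inverse (inverse \<delta>)"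
        using t \<open>0 < inverse \<delta>\<close> by (intro less_imp_inverse_less) auto
      finally have "dist (ray x t) (0, zigzag x t) < \<delta>" by simp
      moreover have "(0, zigzag x t) \<in> spiral x" using I zigzag_bounds[of x t] by auto
      ultimately have "dist (f (ray x t)) (f (0, zigzag x t)) < \<epsilon>"
        using \<delta>(2) rayS[of t] \<open>t > 0\<close> by simp
      then show "dist (f (ray x t)) (0, h (zigzag x t)) < \<epsilon>"
        using hs[of "zigzag x t"] zigzag_bounds[of x t] by simp
    qed
  qed
  have close: "\<exists>T>0. \<forall>t\<ge>T. \<bar>zigzag y (\<phi> t) - h (zigzag x t)\<bar> < \<epsilon> \<and> inverse (1 + \<phi> t) < \<epsilon>" if "\<epsilon> > 0" for \<epsilon>
  proof -
    obtain T where T: "T > 0" "\<And>t. t \<ge> T \<Longrightarrow> dist (f (ray x t)) (0, h (zigzag x t)) < \<epsilon>"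
      using near[OF \<open>\<epsilon> > 0\<close>] by blast
    have "\<bar>zigzag y (\<phi> t) - h (zigzag x t)\<bar> < \<epsilon> \<and> inverse (1 + \<phi> t) < \<epsilon>" if "t \<ge> T" for t
    proof -
      have pos: "\<phi> t > 0" and ft: "f (ray x t) = ray y (\<phi> t)" using phi[of t] T(1) that by auto
      have d: "dist (ray y (\<phi> t)) (0, h (zigzag x t)) < \<epsilon>" using T(2)[OF that] unfolding ft .
      have "dist (inverse (1 + \<phi> t)) 0 < \<epsilon>" "dist (zigzag y (\<phi> t)) (h (zigzag x t)) < \<epsilon>"
        using dist_fst_le[of "ray y (\<phi> t)" "(0, h (zigzag x t))"]
          dist_snd_le[of "ray y (\<phi> t)" "(0, h (zigzag x t))"] d
        by (simp_all add: ray_def)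
      then show ?thesis using pos by (simp add: dist_real_def)
    qed
    then show ?thesis using T(1) by blast
  qed
  have contphi: "continuous_on {0<..} \<phi>"
    unfolding \<phi>_def
  proof (intro continuous_intros ballI)
    show "continuous_on {0<..} (\<lambda>t. f (ray x t))"
      by (rule continuous_on_compose2[OF f(1) continuous_on_ray]) (use rayS in auto)
    fix t :: real assume "t \<in> {0<..}"
    then show "fst (f (ray x t)) \<noteq> 0" using phi[of t] by (auto simp: ray_def)
  qed
  have injphi: "inj_on \<phi> {0<..}"
  proof (rule inj_onI)
    fix s t assume "s \<in> {0<..}" "t \<in> {0<..}" "\<phi> s = \<phi> t"
    then have "f (ray x s) = f (ray x t)" using phi[of s] phi[of t] by simp
    then have "ray x s = ray x t" using injf rayS \<open>s \<in> _\<close> \<open>t \<in> _\<close> by auto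
    then show "s = t" using ray_inj \<open>s \<in> _\<close> \<open>t \<in> _\<close> by auto
  qed
  have sm: "strict_mono_on {0<..} \<phi>"
  proof (rule strict_mono_onI)
    fix a b :: real assume ab: "a \<in> {0<..}" "b \<in> {0<..}" "a < b"
    have pos: "\<phi> a > 0" "\<phi> b > 0" using phi ab by auto
    obtain T where T: "T > 0" "\<And>t. t \<ge> T \<Longrightarrow> inverse (1 + \<phi> t) < inverse (1 + \<phi> b)"
      using close[of "inverse (1 + \<phi> b)"] pos by auto
    \<comment> \<open>An injective continuous map is increasing or decreasing on
      \<open>{a..c}\<close>. Since \<open>\<phi>\<close> tends to infinity, a point \<open>c\<close>
      far out excludes the decreasing case.\<close>
    define c where "c = max T (b + 1)"
    have c: "b < c" "T \<le> c" by (auto simp: c_def)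
    have "\<phi> c > 0" using phi[of c] c ab by auto
    then have "\<phi> b < \<phi> c"
      using T(2)[OF c(2)] pos by (simp add: inverse_less_iff_less)
    moreover have "{a..c} \<subseteq> {0<..}" using ab by auto
    then have "\<phi> a < \<phi> b \<and> \<phi> b < \<phi> c \<or> \<phi> c < \<phi> b \<and> \<phi> b < \<phi> a"
      using ab c by (intro continuous_inj_imp_mono continuous_on_subset[OF contphi] inj_on_subset[OF injphi])
    ultimately show "\<phi> a < \<phi> b" by linarith
  qed
  have "\<exists>T>0. \<forall>t\<ge>T. \<bar>zigzag y (\<phi> t) - h (zigzag x t)\<bar> < \<epsilon>" if "\<epsilon> > 0" for \<epsilon>
    using close[OF that] by blast
  then have "matching x y \<phi> h"
    using sm phi by (simp add: matching_def)
  then show ?thesis using that phi hs conth by blast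
qed

section \<open>Counting peaks and excluding a reversal of the remainder\<close>

text \<open>Far out, consecutive peaks of \<open>x\<close> go to high places of \<open>y\<close>
  with a low place between them. By quasiconcavity these lie in different blocks, so the block
  number grows by at least one per peak.\<close>

lemma matching_peak_growth:
  assumes m: "matching x y \<phi> h" and h: "h 0 = 0" "0 < h (1/2)" "0 < h 1"
  obtains n0 where "\<And>n. real n \<le> \<phi> (real n + 1/2) + real n0"
proof -
  define c where "c = min (h (1/2)) (h 1)"
  have c: "c > 0" "c \<le> h (1/2)" "c \<le> h 1" using h by (auto simp: c_def)
  \<comment> \<open>With error \<open>c / 3\<close>, images of peaks stay above
    \<open>2 * c / 3\<close> and images of zeros stay below \<open>c / 3\<close>.\<close>
  obtain T where T: "T > 0" "\<And>t. t \<ge> T \<Longrightarrow> \<bar>zigzag y (\<phi> t) - h (zigzag x t)\<bar> < c / 3"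
  proof -
    have "c / 3 > 0" using c(1) by simp
    from matching_close[OF m this] show ?thesis using that by blast
  qed
  obtain n0 where n0: "T \<le> real n0" using real_arch_simple by blast
  have mono: "\<phi> a < \<phi> b" if "0 < a" "a < b" for a b
    using matching_less[OF m that] .
  have pos: "0 < \<phi> a" if "0 < a" for a using matching_pos[OF m that] .
  define \<mu> where "\<mu> n = nat \<lfloor>\<phi> (real n + 1/2)\<rfloor>" for n
  have mu: "real (\<mu> n) \<le> \<phi> (real n + 1/2)" "\<phi> (real n + 1/2) < real (\<mu> n) + 1" for n
    using pos[of "real n + 1/2"] unfolding \<mu>_def by (auto simp: of_nat_nat)
  have peak: "2 * c / 3 < zigzag y (\<phi> (real n + 1/2))" if "n \<ge> n0" for n
  proof -
    have "\<bar>zigzag y (\<phi> (real n + 1/2)) - h (zigzag x (real n + 1/2))\<bar> < c / 3"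
      by (rule T(2)) (use that n0 in linarith)
    moreover have "c \<le> h (zigzag x (real n + 1/2))" unfolding zigzag_peak using c by simp
    ultimately show ?thesis by linarith
  qed
  have zero: "zigzag y (\<phi> (real n)) < c / 3" if "n \<ge> n0" for n
    using T(2)[of "real n"] that n0 zigzag_nat[of x n] h(1) by auto
  have step: "\<mu> n < \<mu> (Suc n)" if n: "n \<ge> n0" for n
  proof (rule ccontr)
    assume "\<not> \<mu> n < \<mu> (Suc n)"
    then have le: "real (\<mu> (Suc n)) \<le> real (\<mu> n)" by simp
    have lt: "\<phi> (real n + 1/2) < \<phi> (real (Suc n))" "\<phi> (real (Suc n)) < \<phi> (real (Suc n) + 1/2)"
      by (auto intro!: mono)
    have "min (zigzag y (\<phi> (real n + 1/2))) (zigzag y (\<phi> (real (Suc n) + 1/2))) \<le> zigzag y (\<phi> (real (Suc n)))"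
      by (rule zigzag_quasiconcave[of "\<mu> n"]) (use mu(1)[of n] mu(2)[of "Suc n"] lt le in linarith)+
    moreover have "2 * c / 3 < min (zigzag y (\<phi> (real n + 1/2))) (zigzag y (\<phi> (real (Suc n) + 1/2)))"
      using peak[of n] peak[of "Suc n"] n by simp
    moreover have "zigzag y (\<phi> (real (Suc n))) < c / 3" using zero[of "Suc n"] n by simp
    ultimately show False using c(1) by linarith
  qed
  have ge: "i \<le> \<mu> (n0 + i)" for i
  proof (induction i)
    case (Suc i)
    then show ?case using step[of "n0 + i"] by simp
  qed simp
  have "real n \<le> \<phi> (real n + 1/2) + real n0" for n
  proof (cases "n \<ge> n0")
    case True
    then have "n - n0 \<le> \<mu> n" using ge[of "n - n0"] by simp
    then have "real n - real n0 \<le> real (\<mu> n)" using True by linarith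
    then show ?thesis using mu(1)[of n] by linarith
  next
    case False
    then show ?thesis using pos[of "real n + 1/2"] by simp
  qed
  then show ?thesis by (rule that)
qed

text \<open>If \<open>h\<close> reversed the arc, a late low block of \<open>x\<close> would begin
  and end near height \<open>1\<close> of \<open>y\<close> and dip in between. The dip forces an
  integer \<open>j\<close>, where \<open>zigzag y\<close> vanishes, into the image of the block. But
  on a low block \<open>h\<close> stays at or above \<open>h (1/2) > 0\<close>.\<close>

lemma matching_preserves_orientation:
  assumes x: "x \<in> infinitely_often False" and m: "matching x y \<phi> h"
    and inv: "\<And>s. s > 0 \<Longrightarrow> \<psi> s > 0" "\<And>s. s > 0 \<Longrightarrow> \<phi> (\<psi> s) = s"
    and h: "continuous_on {0..1} h" "inj_on h {0..1}" "h ` {0..1} \<subseteq> {0..1}"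
  shows "\<not> (h 0 = 1 \<and> h 1 = 0)"
proof
  assume h01: "h 0 = 1 \<and> h 1 = 0"
  have low: "h (1/2) \<le> h v" if v: "0 \<le> v" "v \<le> 1/2" for v
  proof (cases "v = 1/2")
    case False
    have "h v < h (1/2) \<and> h (1/2) < h 1 \<or> h 1 < h (1/2) \<and> h (1/2) < h v"
      by (rule continuous_inj_imp_mono)
        (use v False in \<open>auto intro: continuous_on_subset[OF h(1)] inj_on_subset[OF h(2)]\<close>)
    moreover have "h (1/2) \<in> {0..1}" "h v \<in> {0..1}"
      by (rule subsetD[OF h(3)], rule imageI, use v in simp)+
    ultimately show ?thesis using h01 by auto
  next
    case True
    then show ?thesis by (simp only: order.refl)
  qed
  have hhalf: "0 < h (1/2)" "h (1/2) < 1"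
  proof -
    have "h (1/2) \<in> {0..1}" by (rule subsetD[OF h(3)], rule imageI) simp
    moreover have "h (1/2) \<noteq> h 0" "h (1/2) \<noteq> h 1" using inj_on_eq_iff[OF h(2)] by auto
    ultimately show "0 < h (1/2)" "h (1/2) < 1" using h01 by auto
  qed
  define \<epsilon> where "\<epsilon> = min (h (1/2)) (1 - h (1/2)) / 3"
  have \<epsilon>: "\<epsilon> > 0" "3 * \<epsilon> \<le> h (1/2)" "3 * \<epsilon> \<le> 1 - h (1/2)" using hhalf by (auto simp: \<epsilon>_def)
  obtain T where T: "T > 0" "\<And>t. t \<ge> T \<Longrightarrow> \<bar>zigzag y (\<phi> t) - h (zigzag x t)\<bar> < \<epsilon>"
    using matching_close[OF m \<epsilon>(1)] by blast
  obtain m0 where m0: "T \<le> real m0" using real_arch_simple by blast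
  obtain n where n: "n \<ge> m0" "\<not> x n" using x by (auto simp: infinitely_often_def)
  have nT: "T \<le> real n" using n m0 by linarith
  have mono: "\<phi> a < \<phi> b" if "0 < a" "a < b" for a b
    using matching_less[OF m that] .
  have pos: "0 < \<phi> a" if "0 < a" for a using matching_pos[OF m that] .
  have v0: "1 - \<epsilon> < zigzag y (\<phi> (real n))" and v1: "1 - \<epsilon> < zigzag y (\<phi> (real n + 1))"
    using T(2)[of "real n"] T(2)[of "real n + 1"] nT zigzag_nat[of x n] zigzag_nat[of x "Suc n"] h01
    by (auto simp: add.commute)
  have vm: "zigzag y (\<phi> (real n + 1/2)) < 1 - 2 * \<epsilon>"
    using T(2)[of "real n + 1/2"] nT zigzag_peak[of x n] n(2) \<epsilon>(3) by (auto simp: abs_less_iff)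
  define j where "j = nat \<lfloor>\<phi> (real n + 1)\<rfloor>"
  have npos: "0 < real n" using nT T(1) by linarith
  have j: "real j \<le> \<phi> (real n + 1)" "\<phi> (real n + 1) < real j + 1"
    using pos[of "real n + 1"] unfolding j_def by (auto simp: of_nat_nat)
  have lt: "\<phi> (real n) < \<phi> (real n + 1/2)" "\<phi> (real n + 1/2) < \<phi> (real n + 1)"
    using npos by (auto intro!: mono)
  \<comment> \<open>Otherwise the image of the whole block of \<open>x\<close> would lie in the
    single block \<open>j\<close> of \<open>y\<close>, where a dip contradicts
    quasiconcavity.\<close>
  have "\<phi> (real n) < real j"
  proof (rule ccontr)
    assume "\<not> \<phi> (real n) < real j"
    then have "min (zigzag y (\<phi> (real n))) (zigzag y (\<phi> (real n + 1))) \<le> zigzag y (\<phi> (real n + 1/2))"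
      by (intro zigzag_quasiconcave[of j]) (use j lt in linarith)+
    then show False using v0 v1 vm \<epsilon>(1) by (simp add: min_def split: if_splits)
  qed
  then have jpos: "0 < real j" using pos[OF npos] by linarith
  let ?s = "\<psi> (real j)"
  have s: "0 < ?s" "\<phi> ?s = real j" using inv jpos by auto
  have "real n < ?s"
  proof (rule ccontr)
    assume "\<not> real n < ?s"
    then have "\<phi> ?s \<le> \<phi> (real n)" using mono[of ?s "real n"] s(1) by (cases "?s = real n") auto
    then show False using s(2) \<open>\<phi> (real n) < real j\<close> by linarith
  qed
  moreover have "?s \<le> real n + 1"
  proof (rule ccontr)
    assume "\<not> ?s \<le> real n + 1"
    then have "\<phi> (real n + 1) < \<phi> ?s" using mono[of "real n + 1" ?s] npos by auto
    then show False using s(2) j(1) by linarith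
  qed
  ultimately have "zigzag x ?s \<le> 1/2" by (intro zigzag_low[of n]) (use n(2) in auto)
  then have "h (1/2) \<le> h (zigzag x ?s)" by (intro low zigzag_bounds)
  moreover have "\<bar>zigzag y (\<phi> ?s) - h (zigzag x ?s)\<bar> < \<epsilon>"
    using T(2)[of ?s] nT \<open>real n < ?s\<close> by linarith
  ultimately show False using s(2) zigzag_nat[of y j] \<epsilon> by (simp add: abs_less_iff)
qed

text \<open>The peaks of height \<open>1\<close> of \<open>spiral x\<close> have to be matched with peaks of height \<open>1\<close> of \<open>spiral y\<close>,
  and up to a bounded shift the \<open>n\<close>-th peak cannot come before the \<open>n\<close>-th peak on the other side.
  A sufficiently long run of low peaks of \<open>y\<close> therefore swallows a high peak of \<open>x\<close>.\<close>

lemma not_homeomorphic_spirals: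
  assumes x: "x \<in> infinitely_often True" "x \<in> infinitely_often False" and y: "y \<in> infinitely_often True"
    and r: "\<And>k. \<exists>n\<ge>2 * k + 1. x n \<and> n + k + 1 \<le> r k"
    and run: "\<And>m. \<exists>k\<ge>m. \<forall>i\<in>{k..r k}. \<not> y i"
  shows "\<not> spiral x homeomorphic spiral y"
proof
  assume "spiral x homeomorphic spiral y"
  then obtain f g where hom: "homeomorphism (spiral x) (spiral y) f g"
    unfolding homeomorphic_def by blast
  obtain \<phi> h where F: "matching x y \<phi> h" "\<And>t. t > 0 \<Longrightarrow> f (ray x t) = ray y (\<phi> t)"
    "\<And>s. s \<in> {0..1} \<Longrightarrow> h s \<in> {0..1} \<and> f (0, s) = (0, h s)" "continuous_on {0..1} h"
    by (rule spiral_homeomorphism_matching[OF x(1) y hom]) blast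
  obtain \<psi> k where G: "matching y x \<psi> k" "\<And>t. t > 0 \<Longrightarrow> g (ray y t) = ray x (\<psi> t)"
    "\<And>s. s \<in> {0..1} \<Longrightarrow> k s \<in> {0..1} \<and> g (0, s) = (0, k s)" "continuous_on {0..1} k"
    by (rule spiral_homeomorphism_matching[OF y x(1) homeomorphism_symD[OF hom]]) blast
  have gf: "\<And>p. p \<in> spiral x \<Longrightarrow> g (f p) = p" and fg: "\<And>p. p \<in> spiral y \<Longrightarrow> f (g p) = p"
    using hom unfolding homeomorphism_def by auto
  have phipos: "\<phi> t > 0" if "t > 0" for t using matching_pos[OF F(1) that] .
  have psipos: "\<psi> t > 0" if "t > 0" for t using matching_pos[OF G(1) that] .
  have phipsi: "\<phi> (\<psi> s) = s" if s: "s > 0" for s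
  proof -
    have "ray y s \<in> spiral y" using s by (auto simp: spiral_eq[OF y])
    then have "f (g (ray y s)) = ray y s" by (rule fg)
    then have "ray y (\<phi> (\<psi> s)) = ray y s"
      unfolding G(2)[OF s] F(2)[OF psipos[OF s]] .
    then show ?thesis by (rule ray_inj[rotated 2]) (use phipos[OF psipos[OF s]] s in auto)
  qed
  have kh: "k (h s) = s" if s: "s \<in> {0..1}" for s
  proof -
    have "(0, s) \<in> spiral x" using s by (auto simp: spiral_eq[OF x(1)])
    then have "g (f (0, s)) = (0, s)" by (rule gf)
    then have "g (0, h s) = (0, s)" using F(3)[OF s] by simp
    then show ?thesis using G(3)[of "h s"] F(3)[OF s] by simp
  qed
  have hk: "h (k s) = s" if s: "s \<in> {0..1}" for s
  proof -
    have "(0, s) \<in> spiral y" using s by (auto simp: spiral_eq[OF y])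
    then have "f (g (0, s)) = (0, s)" by (rule fg)
    then have "f (0, k s) = (0, s)" using G(3)[OF s] by simp
    then show ?thesis using F(3)[of "k s"] G(3)[OF s] by simp
  qed
  have injh: "inj_on h {0..1}" by (rule inj_on_inverseI[of _ k]) (rule kh)
  \<comment> \<open>A strictly monotone \<open>h\<close> sends an interior point strictly between
    two values in \<open>{0..1}\<close>, never to an end.\<close>
  have ends: "k s = 0 \<or> k s = 1" if s: "s = 0 \<or> s = 1" for s
  proof (rule ccontr)
    assume "\<not> (k s = 0 \<or> k s = 1)"
    moreover have ks: "k s \<in> {0..1}" using G(3)[of s] s by auto
    ultimately have "h 0 < h (k s) \<and> h (k s) < h 1 \<or> h 1 < h (k s) \<and> h (k s) < h 0"
      by (intro continuous_inj_imp_mono F(4) injh) auto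
    moreover have "h (k s) = s" using hk s by auto
    moreover have "h 0 \<in> {0..1}" "h 1 \<in> {0..1}" using F(3) by auto
    ultimately show False using s by auto
  qed
  have k01: "k 0 = 0 \<and> k 1 = 1"
  proof (rule ccontr)
    assume "\<not> (k 0 = 0 \<and> k 1 = 1)"
    moreover have "k 0 \<noteq> k 1" using hk[of 0] hk[of 1] by auto
    ultimately have "k 0 = 1" "k 1 = 0" using ends[of 0] ends[of 1] by auto
    then have "h 0 = 1 \<and> h 1 = 0" using hk[of 0] hk[of 1] by simp
    moreover have "h ` {0..1} \<subseteq> {0..1}" using F(3) by blast
    ultimately show False
      using matching_preserves_orientation[OF x(2) F(1) psipos phipsi F(4) injh] by blast
  qed
  then have h01: "h 0 = 0" "h 1 = 1" using hk[of 0] hk[of 1] by auto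
  have "h (1/2) \<noteq> 0" using kh[of "1/2"] k01 by auto
  then have hhalf: "0 < h (1/2)" using F(3)[of "1/2"] by auto
  have "k (1/2) \<noteq> 0" using hk[of "1/2"] h01 by auto
  then have khalf: "0 < k (1/2)" using G(3)[of "1/2"] by auto
  obtain n0 where n0: "\<And>n. real n \<le> \<phi> (real n + 1/2) + real n0"
    using matching_peak_growth[OF F(1)] h01 hhalf by auto
  obtain k0 where k0: "\<And>n. real n \<le> \<psi> (real n + 1/2) + real k0"
    using matching_peak_growth[OF G(1)] k01 khalf by auto
  obtain T where T: "T > 0" "\<And>t. t \<ge> T \<Longrightarrow> \<bar>zigzag y (\<phi> t) - h (zigzag x t)\<bar> < 1/2"
  proof -
    have "(0::real) < 1/2" by simp
    from matching_close[OF F(1) this] show ?thesis using that by blast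
  qed
  obtain T' where T': "T \<le> real T'" using real_arch_simple by blast
  \<comment> \<open>The start of the run absorbs both shifts \<open>n0\<close> and \<open>k0\<close>
    and the threshold \<open>T'\<close>. Then \<open>n \<ge> 2 * j + 1\<close> keeps the image of
    peak \<open>n\<close> from landing before the run, and \<open>n + j + 1 \<le> r j\<close> keeps
    it from landing after it.\<close>
  obtain j where j: "j \<ge> n0 + k0 + T'" and low: "\<forall>i\<in>{j..r j}. \<not> y i" using run by blast
  obtain n where n: "n \<ge> 2 * j + 1" "x n" "n + j + 1 \<le> r j" using r by blast
  let ?t = "real n + 1/2"
  have lower: "real j \<le> \<phi> ?t" using n0[of n] n(1) j by linarith
  \<comment> \<open>The upper bound on \<open>\<phi>\<close> comes from peak growth for the inverse:
    peak \<open>r j\<close> of \<open>y\<close> is sent beyond peak \<open>n\<close> of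
    \<open>x\<close>.\<close>
  have "?t < \<psi> (real (r j) + 1/2)"
  proof -
    have "real (r j) \<le> \<psi> (real (r j) + 1/2) + real k0" by (rule k0)
    moreover have "real n + real j + 1 \<le> real (r j)" "real k0 \<le> real j" using n(3) j by linarith+
    ultimately show ?thesis by linarith
  qed
  then have "\<phi> ?t < \<phi> (\<psi> (real (r j) + 1/2))"
    using matching_less[OF F(1), of ?t] by simp
  then have upper: "\<phi> ?t < real (r j) + 1/2" using phipsi[of "real (r j) + 1/2"] by simp
  define i where "i = nat \<lfloor>\<phi> ?t\<rfloor>"
  have i: "real i \<le> \<phi> ?t" "\<phi> ?t < real i + 1"
    using phipos[of ?t] unfolding i_def by (auto simp: of_nat_nat)
  have "real j < real i + 1" "real i < real (r j) + 1" using i lower upper by linarith+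
  then have "i \<in> {j..r j}" by simp
  then have "zigzag y (\<phi> ?t) \<le> 1/2" using low i by (intro zigzag_low[of i]) auto
  moreover have "\<bar>zigzag y (\<phi> ?t) - h (zigzag x ?t)\<bar> < 1/2"
    using T(2)[of ?t] T' n(1) j by linarith
  ultimately show False using zigzag_peak[of x n] n(2) h01(2) by (auto simp: abs_less_iff)
qed

section \<open>Conclusion\<close>

text \<open>Here the copy carries the product topology, so the arguments for compact subsets of a
  complete second countable type apply to it. The embedding records the distances to a countable
  dense set.\<close>

lemma compact_metrizable_embeds_in_sequences:
  fixes X :: "'a topology"
  assumes "compact_space X" "metrizable_space X"
  obtains K :: "(nat \<Rightarrow> real) set" where "compact K" "X homeomorphic_space top_of_set K"
proof -
  obtain M d where "Metric_space M d" and X: "X = Metric_space.mtopology M d"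
    using assms(2) unfolding metrizable_space_def by blast
  interpret Metric_space M d by fact
  have "mtotally_bounded M"
    using assms(1) X compact_space_eq_mcomplete_mtotally_bounded by blast
  then have "\<forall>n::nat. \<exists>Q. finite Q \<and> Q \<subseteq> M \<and> M \<subseteq> (\<Union>x\<in>Q. mball x (inverse (Suc n)))"
    unfolding mtotally_bounded_def by (metis inverse_positive_iff_positive of_nat_0_less_iff zero_less_Suc)
  then obtain Q where Q: "\<And>n::nat. finite (Q n)" "\<And>n. Q n \<subseteq> M"
    "\<And>n. M \<subseteq> (\<Union>x\<in>Q n. mball x (inverse (Suc n)))"
    by metis
  define D where "D = (\<Union>n. Q n)"
  have D: "countable D" unfolding D_def using Q(1) by (simp add: countable_finite)
  have DM: "D \<subseteq> M" using Q(2) by (auto simp: D_def)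
  \<comment> \<open>If \<open>D\<close> is empty, \<open>from_nat_into D n\<close> need not lie in
    \<open>M\<close>; the default \<open>0\<close> keeps every coordinate continuous.\<close>
  define g where "g x n = (if D = {} then 0 else d x (from_nat_into D n))" for x n
  have inj: "inj_on g M"
  proof (rule inj_onI, rule ccontr)
    fix x y assume xy: "x \<in> M" "y \<in> M" "g x = g y" "x \<noteq> y"
    then have "d x y / 2 > 0" by simp
    then obtain n where n: "inverse (Suc n) < d x y / 2"
      using reals_Archimedean by blast
    obtain q where q: "q \<in> Q n" "x \<in> mball q (inverse (Suc n))"
      using Q(3) xy(1) by blast
    then have "q \<in> D" by (auto simp: D_def)
    then obtain m where m: "from_nat_into D m = q"
      using from_nat_into_surj[OF D] by blast
    have "D \<noteq> {}" using \<open>q \<in> D\<close> by blast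
    then have "d x q = d y q" using fun_cong[OF xy(3), of m] m by (simp add: g_def)
    moreover have "d x q < d x y / 2" using q n by (auto simp: commute)
    moreover have "d x y \<le> d x q + d q y"
      using xy(1,2) \<open>q \<in> D\<close> DM by (intro triangle) auto
    ultimately show False by (simp add: commute)
  qed
  have "continuous_map mtopology euclideanreal (\<lambda>x. g x n)" for n
  proof (cases "D = {}")
    case False
    then have "from_nat_into D n \<in> M" using from_nat_into[OF False, of n] DM by auto
    then have Lip: "\<bar>d a (from_nat_into D n) - d x (from_nat_into D n)\<bar> \<le> d a x"
      if "a \<in> M" "x \<in> M" for a x
      using triangle[OF that(1,2), of "from_nat_into D n"] triangle[OF that(2,1), of "from_nat_into D n"]
        commute[of a x] by (simp add: abs_le_iff)
    have "continuous_map mtopology Met_TC.mtopology (\<lambda>x. d x (from_nat_into D n))"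
      unfolding metric_continuous_map[OF Met_TC.Metric_space_axioms] dist_real_def
    proof (intro conjI ballI allI impI)
      fix a :: 'a and \<epsilon> :: real assume a: "a \<in> M" and "\<epsilon> > 0"
      show "\<exists>\<delta>>0. \<forall>x. x \<in> M \<and> d a x < \<delta> \<longrightarrow>
          \<bar>d a (from_nat_into D n) - d x (from_nat_into D n)\<bar> < \<epsilon>"
      proof (intro exI[of _ \<epsilon>] conjI allI impI)
        show "\<epsilon> > 0" by fact
        fix x assume "x \<in> M \<and> d a x < \<epsilon>"
        then show "\<bar>d a (from_nat_into D n) - d x (from_nat_into D n)\<bar> < \<epsilon>"
          using Lip[OF a, of x] by linarith
      qed
    qed simp
    then show ?thesis using False by (simp add: g_def)
  qed (simp add: g_def)
  then have "continuous_map X (product_topology (\<lambda>_. euclideanreal) UNIV) g"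
    unfolding X by (intro continuous_map_coordinatewise_then_product) auto
  then have cont: "continuous_map X euclidean g" by (simp add: euclidean_product_topology)
  have tX: "topspace X = M" by (simp add: X)
  have "compact (g ` M)"
    using image_compactin[OF _ cont, of M] assms(1) tX by (simp add: compact_space_def)
  moreover have "homeomorphic_map X (top_of_set (g ` M)) g"
  proof (rule continuous_imp_homeomorphic_map[OF _ assms(1)])
    show "Hausdorff_space (top_of_set (g ` M))" by (simp add: Hausdorff_space_subtopology)
    show "continuous_map X (top_of_set (g ` M)) g"
      using cont tX by (simp add: continuous_map_in_subtopology)
  qed (use tX inj in auto)
  ultimately show ?thesis
    using that homeomorphic_map_imp_homeomorphic_space by blast
qed

lemma homeomorphic_space_top_of_set_iff:
  "top_of_set S homeomorphic_space top_of_set T \<longleftrightarrow> S homeomorphic T"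
  unfolding homeomorphic_space_def homeomorphic_maps_def homeomorphic_minimal
  by (intro iff_exI) (auto simp: continuous_map_in_subtopology Pi_iff)

lemma connected_components_of_top_of_set: "connected_components_of (top_of_set K) = components K"
proof -
  have "connected_component_of (top_of_set K) x y \<longleftrightarrow> connected_component K x y" for x y
    by (auto simp: connected_component_of_def connected_component_def connectedin_subtopology)
  then have "connected_component_of (top_of_set K) = connected_component K" by (intro ext)
  then show ?thesis
    unfolding connected_components_of_def components_def by simp
qed

text \<open>Moves the uniqueness hypothesis from the abstract space \<open>X\<close> and the copy
  \<open>T\<close> to the concrete sets \<open>K\<close> and \<open>S\<close>.\<close>

lemma unique_component_transfer:
  assumes hom: "X homeomorphic_space top_of_set K"
    and S: "top_of_set S homeomorphic_space T"
    and unique: "\<exists>!C. C \<in> connected_components_of X \<and> T homeomorphic_space subtopology X C"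
  shows "\<exists>!C. C \<in> components K \<and> S homeomorphic C"
proof -
  obtain f where f: "homeomorphic_map X (top_of_set K) f"
    using hom homeomorphic_space by blast
  have comps: "components K = image f ` connected_components_of X"
    using homeomorphic_map_connected_components_of[OF f] by (simp add: connected_components_of_top_of_set)
  have iff: "S homeomorphic f ` C \<longleftrightarrow> T homeomorphic_space subtopology X C"
    if C: "C \<in> connected_components_of X" for C
  proof -
    have CX: "C \<subseteq> topspace X" using C by (rule connected_components_of_subset)
    have fK: "f ` topspace X = K" using homeomorphic_imp_surjective_map[OF f] by simp
    then have fC: "f ` C \<subseteq> K" using CX by blast
    have "homeomorphic_map (subtopology X C) (subtopology (top_of_set K) (f ` C)) f"
      by (rule homeomorphic_map_subtopologies[OF f]) (use CX fC in \<open>auto simp: inf_absorb2\<close>)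
    then have XC: "subtopology X C homeomorphic_space top_of_set (f ` C)"
      using fC by (simp add: subtopology_subtopology inf_absorb2 homeomorphic_map_imp_homeomorphic_space)
    have "T homeomorphic_space subtopology X C \<longleftrightarrow> top_of_set S homeomorphic_space top_of_set (f ` C)"
    proof
      assume "T homeomorphic_space subtopology X C"
      then show "top_of_set S homeomorphic_space top_of_set (f ` C)"
        using homeomorphic_space_trans[OF S] homeomorphic_space_trans[OF _ XC] by blast
    next
      assume "top_of_set S homeomorphic_space top_of_set (f ` C)"
      then have "T homeomorphic_space top_of_set (f ` C)"
        by (rule homeomorphic_space_trans[OF S[THEN homeomorphic_space_sym[THEN iffD1]]])
      then show "T homeomorphic_space subtopology X C"
        by (rule homeomorphic_space_trans[OF _ XC[THEN homeomorphic_space_sym[THEN iffD1]]])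
    qed
    then show ?thesis by (simp add: homeomorphic_space_top_of_set_iff)
  qed
  obtain C where C: "C \<in> connected_components_of X" "T homeomorphic_space subtopology X C"
    using unique by blast
  show ?thesis
  proof (intro ex1I[of _ "f ` C"] conjI)
    show "f ` C \<in> components K" using C comps by blast
    show "S homeomorphic f ` C" using iff[OF C(1)] C(2) by simp
    fix C' assume C': "C' \<in> components K \<and> S homeomorphic C'"
    then obtain C0 where C0: "C0 \<in> connected_components_of X" "C' = f ` C0" using comps by blast
    then have "T homeomorphic_space subtopology X C0" using C' iff[OF C0(1)] by simp
    then have "C0 = C" using C C0(1) unique by blast
    then show "C' = f ` C" using C0 by simp
  qed
qed

theorem mainTheorem1:
  shows "\<not> (\<exists>X :: 'a topology. compact_space X \<and> metrizable_space X \<and>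
           (\<forall>S :: (nat \<Rightarrow> real) topology. spiral_over (top_of_set {0..1::real}) S \<longrightarrow>
             (\<exists>!C. C \<in> connected_components_of X \<and> S homeomorphic_space subtopology X C)))"
proof
  assume "\<exists>X :: 'a topology. compact_space X \<and> metrizable_space X \<and>
           (\<forall>S :: (nat \<Rightarrow> real) topology. spiral_over (top_of_set {0..1::real}) S \<longrightarrow>
             (\<exists>!C. C \<in> connected_components_of X \<and> S homeomorphic_space subtopology X C))"
  then obtain X :: "'a topology" where X: "compact_space X" "metrizable_space X"
    and unique: "\<And>S :: (nat \<Rightarrow> real) topology. spiral_over (top_of_set {0..1::real}) S \<Longrightarrow>
             \<exists>!C. C \<in> connected_components_of X \<and> S homeomorphic_space subtopology X C"
    by blast
  obtain K :: "(nat \<Rightarrow> real) set" where K: "compact K" "X homeomorphic_space top_of_set K"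
    using compact_metrizable_embeds_in_sequences[OF X] .
  have "\<exists>!C. C \<in> components K \<and> spiral x homeomorphic C" if x: "x \<in> infinitely_often True" for x
  proof -
    obtain T :: "(nat \<Rightarrow> real) topology"
      where T: "spiral_over (top_of_set {0..1::real}) T" "top_of_set (spiral x) homeomorphic_space T"
      using spiral_over_homeomorphic_copy[OF spiral_over_spiral[OF x]] by blast
    show ?thesis by (rule unique_component_transfer[OF K(2) T(2) unique[OF T(1)]])
  qed
  then obtain G where G: "meager (- G)" "\<And>x y. x \<in> G \<Longrightarrow> y \<in> G \<Longrightarrow> spiral x homeomorphic spiral y"
    using comeager_class_of_components[where E = ray_point and K = K and J = "infinitely_often True",
        unfolded closure_range_ray_point]
      continuous_on_ray_point compact_spiral connected_spiral K(1) spiral_homeomorphic_flip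
      meager_not_infinitely_often by metis
  have inhabited: "\<exists>x. x \<notin> A" if "meager A" for A :: "(nat \<Rightarrow> bool) set"
    using that bool_functions_open_not_meager[of UNIV] by (metis UNIV_not_empty UNIV_eq_I open_UNIV)
  obtain x where x: "x \<in> G" "x \<in> infinitely_often True" "x \<in> infinitely_often False"
    using inhabited[OF meager_Un[OF G(1) meager_Un[OF meager_not_infinitely_often[of True]
          meager_not_infinitely_often[of False]]]] by blast
  have "\<exists>n\<ge>2 * k + 1. x n" for k using x(2) by (simp add: infinitely_often_def)
  then obtain n where n: "\<And>k. n k \<ge> 2 * k + 1" "\<And>k. x (n k)" by metis
  \<comment> \<open>The required run length depends on \<open>x\<close> alone, so \<open>y\<close>
    can be chosen generic relative to it afterwards.\<close>
  define r where "r k = n k + k + 1" for k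
  obtain y where y: "y \<in> G" "y \<in> infinitely_often True"
    "y \<notin> {y. \<exists>m. \<forall>k\<ge>m. \<exists>i\<in>{k..r k}. y i \<noteq> False}"
    using inhabited[OF meager_Un[OF G(1) meager_Un[OF meager_not_infinitely_often[of True]
          meager_eventually_no_run[of r False]]]] by blast
  have "\<not> spiral x homeomorphic spiral y"
  proof (rule not_homeomorphic_spirals[OF x(2,3) y(2)])
    show "\<exists>n\<ge>2 * k + 1. x n \<and> n + k + 1 \<le> r k" for k
      using n by (intro exI[of _ "n k"]) (simp add: r_def)
    show "\<exists>k\<ge>m. \<forall>i\<in>{k..r k}. \<not> y i" for m using y(3) by simp
  qed
  then show False using G(2) x(1) y(1) by blast
qed

end
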